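(* Let $\kappa\in\{1,-1\}$. The space $N(\kappa)$ is isometric to the extrinsic symmetric space $$M:=\{(\eta_1,-\tfrac12|\eta_2|^2,\eta_2)\mid\eta_1,\eta_2\in\mathbb C\}\subset\mathbb C\oplus\mathbb R\oplus\mathbb C,$$ where the scalar product $\langle\cdot,\cdot\rangle$ on $\mathbb C\oplus\mathbb R\oplus\mathbb C$ with coordinates $\eta_1,x,\eta_2$ is $d\eta_1d\bar\eta_2+d\bar\eta_1d\eta_2+\kappa\,dx^2$. An isometry from the pseudo-Hermitian symmetric space $N(\kappa)=\mathbb C^2$ onto this extrinsic symmetric space is $$\iota:\ N(\kappa)=\mathbb C^2\longrightarrow M,\qquad(\xi_1,\xi_2)\longmapsto\big(\xi_1-\tfrac\kappa4|\xi_2|^2\xi_2,\ -\tfrac12|\xi_2|^2,\ \xi_2\big).$$ If we identify $\mathbb C\cong\mathbb R^2$, then the extrinsic transvection group of $M$ is the subgroup $$\left\{\left.\left(\begin{array}{ccc|c} I & \kappa X & -\frac\kappa2XX^\top+Y & Z \\ 0 & 1 & -X^\top & -\frac12X^\top X \\ 0 & 0 & I & X \end{array}\right)\ \right|\ X,Z\in\mathbb R^2,\ Y=\begin{pmatrix} 0 & -y \\ y & 0 \end{pmatrix},\ y\in\mathbb R\right\}$$ of the group of affine isometries of $(\mathbb C\oplus\mathbb R\oplus\mathbb C,\langle\cdot,\cdot\rangle)$, and it is isomorphic to the (ordinary) transvection group $\hat G$ of $N(\kappa)$. The group of all extrinsic isometries of $M$ is equal to $\mathrm O(2)\ltimes\hat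 G$, where $\mathrm O(2)$ is understood as $\{\mathrm{diag}(S,1,S)\mid S\in\mathrm O(2)\}\subset\mathrm{SO}(\mathbb C\oplus\mathbb R\oplus\mathbb C,\langle\cdot,\cdot\rangle)$ and $\hat G$ as the extrinsic transvection group above.
   Context: $N(\kappa)$ is the simply-connected pseudo-Riemannian symmetric space $\tilde G/\tilde G_+$ defined by: the Lie algebra $\hat{\mathfrak g}$ with basis $\sigma^1,\sigma^2,a_0,e_1,e_2$ and non-vanishing brackets $[e_1,e_2]=a_0$, $[e_1,a_0]=-\kappa\sigma^2$, $[e_2,a_0]=\kappa\sigma^1$ (up to antisymmetry); the inner product with $\langle\sigma^i,e_j\rangle=\delta_{ij}$, $\langle a_0,a_0\rangle=\kappa$, all other products of basis vectors zero; the involution $\theta$ that is $-1$ on $\sigma^i,e_i$ and $+1$ on $a_0$; $\tilde G$ the simply-connected Lie group with Lie algebra $\hat{\mathfrak g}$, $\tilde G_+$ the connected subgroup with Lie algebra $\mathbb Ra_0$, and the $\tilde G$-invariant metric given at the base point by the restriction of $\langle\cdot,\cdot\rangle$ to the $(-1)$-eigenspace of $\theta$. In suitable coordinates, $N(\kappa)=\mathbb R^2\times\mathbb R^2\ni(v,u)$ with metric $-\frac\kappa3(u_2du_1-u_1du_2)^2+2(du_1dv_2-du_2dv_1)$. With the complex coordinates $\xi_1=\big(v_2+\frac\kappa{12}u_1|u|^2\big)+i\big(-v_1+\frac\kappa{12}u_2|u|^2\big)$, $\xi_2=u_1+iu_2$ this is $N(\kappa)=\mathbb C^2$ with metric $d\xi_1d\bar\xi_2+d\xi_2d\bar\xi_1-\frac\kappa2|\xi_2|^2d\xi_2d\bar\xi_2$;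 this is the identification $N(\kappa)=\mathbb C^2$ used. The (ordinary) transvection group of a symmetric space is the subgroup of its isometry group generated by all compositions of two point symmetries. Extrinsic symmetric: Let $(V,\langle\cdot,\cdot\rangle)$ be a pseudo-Euclidean vector space and $M\hookrightarrow V$ a submanifold such that $\langle\cdot,\cdot\rangle$ is non-degenerate on each tangent space $T_xM\subset V$. For $x\in M$ let $\mathcal N_xM\subset V$ be the affine normal space at $x$ and $s_x:V\to V$ the affine map with $ds_x|_{T_xM}=-\mathrm{id}$, $s_x|_{\mathcal N_xM}=\mathrm{id}$. $M$ is extrinsic symmetric if $s_x(M)=M$ for all $x\in M$; it carries the induced metric. Its extrinsic transvection group is the group generated by all compositions $s_x\circ s_y$, $x,y\in M$. An extrinsic isometry of $M$ is an affine isometry of $V$ that maps $M$ to itself. An augmented matrix $(A\,|\,b)$ denotes the affine map $w\mapsto Aw+b$, in block form with respect to $\mathbb R^2\oplus\mathbb R\oplus\mathbb R^2$. *)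

theory Defs
  imports "HOL-Analysis.Analysis" "HOL-Algebra.Bij" "HOL-Algebra.Generated_Groups"
begin

section \<open>Smooth maps, submanifolds and isometries in Euclidean spaces\<close>

text \<open>
  For open S, \<open>Ck_on k f S\<close> is k-fold continuous differentiability, expressed through iterated
  directional derivatives.
\<close>

primrec Ck_on :: "nat \<Rightarrow> ('a::real_normed_vector \<Rightarrow> 'b::real_normed_vector) \<Rightarrow> 'a set \<Rightarrow> bool" where
  "Ck_on 0 f S \<longleftrightarrow> continuous_on S f"
| "Ck_on (Suc k) f S \<longleftrightarrow>
     (\<forall>x\<in>S. f differentiable (at x)) \<and> (\<forall>v. Ck_on k (\<lambda>x. frechet_derivative f (at x) v) S)"

definition smooth_on :: "('a::real_normed_vector \<Rightarrow> 'b::real_normed_vector) \<Rightarrow> 'a set \<Rightarrow> bool" where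
  "smooth_on f S \<longleftrightarrow> (\<forall>k. Ck_on k f S)"

text \<open>Smoothness on an arbitrary subset, by local smooth extension to open sets.\<close>

definition smooth_map_on ::
    "('a::real_normed_vector \<Rightarrow> 'b::real_normed_vector) \<Rightarrow> 'a set \<Rightarrow> bool" where
  "smooth_map_on f M \<longleftrightarrow>
     (\<forall>x\<in>M. \<exists>U h. open U \<and> x \<in> U \<and> smooth_on h U \<and> (\<forall>y\<in>M \<inter> U. h y = f y))"

definition submanifold :: "'a::euclidean_space set \<Rightarrow> bool" where
  "submanifold M \<longleftrightarrow>
     (\<exists>k. \<forall>x\<in>M. \<exists>U W \<phi> \<psi> (S::'a set).
        open U \<and> x \<in> U \<and> open W \<and> homeomorphism U W \<phi> \<psi> \<and> smooth_on \<phi> U \<and> smooth_on \<psi> W \<and>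
        subspace S \<and> dim S = k \<and> \<phi> ` (M \<inter> U) = S \<inter> W)"

definition tangent_space :: "'a::euclidean_space set \<Rightarrow> 'a \<Rightarrow> 'a set" where
  "tangent_space M x =
     {v. \<exists>\<gamma>::real \<Rightarrow> 'a. \<exists>e>0. smooth_on \<gamma> {-e<..<e} \<and> (\<forall>t\<in>{-e<..<e}. \<gamma> t \<in> M) \<and>
           \<gamma> 0 = x \<and> (\<gamma> has_vector_derivative v) (at 0)}"

text \<open>
  A pseudo-Riemannian metric is a field \<open>g\<close> with \<open>g p v w\<close> the product of the tangent vectors
  v and w at p. The source of an isometry is here a whole Euclidean space carrying such a
  metric; the target is a subset M with a metric h on its tangent vectors.
\<close>

definition isometry_onto ::
    "('a::euclidean_space \<Rightarrow> 'a \<Rightarrow> 'a \<Rightarrow> real) \<Rightarrow> 'b::euclidean_space set \<Rightarrow>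
     ('b \<Rightarrow> 'b \<Rightarrow> 'b \<Rightarrow> real) \<Rightarrow> ('a \<Rightarrow> 'b) \<Rightarrow> bool" where
  "isometry_onto g M h f \<longleftrightarrow>
     smooth_on f UNIV \<and> bij_betw f UNIV M \<and> smooth_map_on (inv_into UNIV f) M \<and>
     (\<forall>p v w. h (f p) (frechet_derivative f (at p) v) (frechet_derivative f (at p) w) = g p v w)"

text \<open>
  All groups of transformations are taken inside the group \<open>BijGroup UNIV\<close> of bijections with
  composition.
\<close>

definition transformation_group :: "('a \<Rightarrow> 'a) set \<Rightarrow> ('a \<Rightarrow> 'a) monoid" where
  "transformation_group H = BijGroup UNIV \<lparr>carrier := H\<rparr>"

definition point_symmetry ::
    "('a::euclidean_space \<Rightarrow> 'a \<Rightarrow> 'a \<Rightarrow> real) \<Rightarrow> 'a \<Rightarrow> ('a \<Rightarrow> 'a) \<Rightarrow> bool" where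
  "point_symmetry g p s \<longleftrightarrow>
     isometry_onto g UNIV g s \<and> s p = p \<and> (s has_derivative (\<lambda>v. - v)) (at p)"

definition transvections :: "('a::euclidean_space \<Rightarrow> 'a \<Rightarrow> 'a \<Rightarrow> real) \<Rightarrow> ('a \<Rightarrow> 'a) set" where
  "transvections g =
     generate (BijGroup UNIV) {s \<circ> t | s t p q. point_symmetry g p s \<and> point_symmetry g q t}"

section \<open>Extrinsic symmetric spaces\<close>

definition scalar_product :: "('a::euclidean_space \<Rightarrow> 'a \<Rightarrow> real) \<Rightarrow> bool" where
  "scalar_product B \<longleftrightarrow>
     bilinear B \<and> (\<forall>v w. B v w = B w v) \<and> (\<forall>v. (\<forall>w. B v w = 0) \<longrightarrow> v = 0)"

definition affine_normal_space ::
    "('a::euclidean_space \<Rightarrow> 'a \<Rightarrow> real) \<Rightarrow> 'a set \<Rightarrow> 'a \<Rightarrow> 'a set" where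
  "affine_normal_space B M x = {x + n | n. \<forall>v\<in>tangent_space M x. B n v = 0}"

definition extrinsic_reflection ::
    "('a::euclidean_space \<Rightarrow> 'a \<Rightarrow> real) \<Rightarrow> 'a set \<Rightarrow> 'a \<Rightarrow> 'a \<Rightarrow> 'a" where
  "extrinsic_reflection B M x =
     (THE s. \<exists>A b. linear A \<and> s = (\<lambda>w. A w + b) \<and>
        (\<forall>v\<in>tangent_space M x. A v = - v) \<and> (\<forall>w\<in>affine_normal_space B M x. s w = w))"

definition extrinsic_symmetric ::
    "('a::euclidean_space \<Rightarrow> 'a \<Rightarrow> real) \<Rightarrow> 'a set \<Rightarrow> bool" where
  "extrinsic_symmetric B M \<longleftrightarrow>
     scalar_product B \<and> submanifold M \<and>
     (\<forall>x\<in>M. \<forall>v\<in>tangent_space M x. (\<forall>w\<in>tangent_space M x. B v w = 0) \<longrightarrow> v = 0) \<and>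
     (\<forall>x\<in>M. extrinsic_reflection B M x ` M = M)"

definition extrinsic_transvections ::
    "('a::euclidean_space \<Rightarrow> 'a \<Rightarrow> real) \<Rightarrow> 'a set \<Rightarrow> ('a \<Rightarrow> 'a) set" where
  "extrinsic_transvections B M =
     generate (BijGroup UNIV)
       {extrinsic_reflection B M x \<circ> extrinsic_reflection B M y | x y. x \<in> M \<and> y \<in> M}"

definition linear_isometries :: "('a::euclidean_space \<Rightarrow> 'a \<Rightarrow> real) \<Rightarrow> ('a \<Rightarrow> 'a) set" where
  "linear_isometries B = {A. linear A \<and> (\<forall>v w. B (A v) (A w) = B v w)}"

definition affine_isometries :: "('a::euclidean_space \<Rightarrow> 'a \<Rightarrow> real) \<Rightarrow> ('a \<Rightarrow> 'a) set" where
  "affine_isometries B = {(\<lambda>w. A w + b) | A b. A \<in> linear_isometries B}"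

definition extrinsic_isometries ::
    "('a::euclidean_space \<Rightarrow> 'a \<Rightarrow> real) \<Rightarrow> 'a set \<Rightarrow> ('a \<Rightarrow> 'a) set" where
  "extrinsic_isometries B M = {f \<in> affine_isometries B. f ` M = M}"

text \<open>The group G is the internal semidirect product of its subgroup K with its normal
  subgroup N.\<close>

definition semidirect_product :: "('a, 'm) monoid_scheme \<Rightarrow> 'a set \<Rightarrow> 'a set \<Rightarrow> bool" where
  "semidirect_product G K N \<longleftrightarrow>
     subgroup K G \<and> N \<lhd> G \<and> K \<inter> N = {\<one>\<^bsub>G\<^esub>} \<and> K <#>\<^bsub>G\<^esub> N = carrier G"

section \<open>The symmetric space N as a homogeneous space\<close>

text \<open>
  The Lie algebra: \<open>(s, a, e)\<close> stands for
  \<open>Re s * \<sigma>1 + Im s * \<sigma>2 + a * a0 + Re e * e1 + Im e * e2\<close>.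
\<close>

type_synonym ghat = "complex \<times> real \<times> complex"

definition \<sigma>1 :: ghat where "\<sigma>1 = (1, 0, 0)"
definition \<sigma>2 :: ghat where "\<sigma>2 = (\<i>, 0, 0)"
definition a0 :: ghat where "a0 = (0, 1, 0)"
definition e1 :: ghat where "e1 = (0, 0, 1)"
definition e2 :: ghat where "e2 = (0, 0, \<i>)"

definition lie_bracket :: "real \<Rightarrow> ghat \<Rightarrow> ghat \<Rightarrow> ghat" where
  "lie_bracket \<kappa> = (\<lambda>(s, a, e) (s', a', e').
     (Re e * Im e' - Im e * Re e') *\<^sub>R a0
     + (Re e * a' - a * Re e') *\<^sub>R (- \<kappa> *\<^sub>R \<sigma>2)
     + (Im e * a' - a * Im e') *\<^sub>R (\<kappa> *\<^sub>R \<sigma>1))"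

definition lie_product :: "real \<Rightarrow> ghat \<Rightarrow> ghat \<Rightarrow> real" where
  "lie_product \<kappa> = (\<lambda>(s, a, e) (s', a', e').
     Re s * Re e' + Im s * Im e' + Re e * Re s' + Im e * Im s' + \<kappa> * a * a')"

definition lie_involution :: "ghat \<Rightarrow> ghat" where
  "lie_involution = (\<lambda>(s, a, e). (- s, a, - e))"

text \<open>The component of an element in the (-1)-eigenspace of the involution.\<close>

definition minus_part :: "ghat \<Rightarrow> ghat" where
  "minus_part X = (1/2) *\<^sub>R (X - lie_involution X)"

lemma lie_bracket_basis:
  "lie_bracket \<kappa> e1 e2 = a0"
  "lie_bracket \<kappa> e1 a0 = - \<kappa> *\<^sub>R \<sigma>2"
  "lie_bracket \<kappa> e2 a0 = \<kappa> *\<^sub>R \<sigma>1"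
  "lie_bracket \<kappa> \<sigma>1 X = 0" "lie_bracket \<kappa> \<sigma>2 X = 0"
  "lie_bracket \<kappa> X Y = - lie_bracket \<kappa> Y X"
  by (auto simp: lie_bracket_def \<sigma>1_def \<sigma>2_def a0_def e1_def e2_def complex_eq_iff zero_prod_def algebra_simps
      split: prod.splits)

lemma lie_bracket_nilpotent:
  "lie_bracket \<kappa> W (lie_bracket \<kappa> X (lie_bracket \<kappa> Y Z)) = 0"
  by (auto simp: lie_bracket_def \<sigma>1_def \<sigma>2_def a0_def complex_eq_iff zero_prod_def split: prod.splits)

text \<open>
  Since the Lie algebra is nilpotent of step three, the simply-connected Lie group is, via the
  exponential map, the Lie algebra with the Baker-Campbell-Hausdorff product, which has no
  terms beyond the double brackets. In this model the exponential map is the identity, the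
  neutral element is 0 and the inverse of x is -x.
\<close>

definition bch :: "real \<Rightarrow> ghat \<Rightarrow> ghat \<Rightarrow> ghat" where
  "bch \<kappa> x y = x + y + (1/2) *\<^sub>R lie_bracket \<kappa> x y
     + (1/12) *\<^sub>R (lie_bracket \<kappa> x (lie_bracket \<kappa> x y) + lie_bracket \<kappa> y (lie_bracket \<kappa> y x))"

lemma bch_assoc: "bch \<kappa> (bch \<kappa> x y) z = bch \<kappa> x (bch \<kappa> y z)"
  by (cases x; cases y; cases z)
     (simp add: bch_def lie_bracket_def \<sigma>1_def \<sigma>2_def a0_def complex_eq_iff field_simps)

lemma bch_neutral: "bch \<kappa> 0 x = x" "bch \<kappa> x 0 = x"
  and bch_inverse: "bch \<kappa> x (- x) = 0" "bch \<kappa> (- x) x = 0"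
  by (cases x; simp add: bch_def lie_bracket_def \<sigma>1_def \<sigma>2_def a0_def complex_eq_iff zero_prod_def)+

definition G_plus :: "ghat set" where
  "G_plus = range (\<lambda>t. t *\<^sub>R a0)"

definition coset_proj :: "real \<Rightarrow> ghat \<Rightarrow> ghat set" where
  "coset_proj \<kappa> x = bch \<kappa> x ` G_plus"

definition N_space :: "real \<Rightarrow> ghat set set" where
  "N_space \<kappa> = range (coset_proj \<kappa>)"

text \<open>
  The invariant metric of the homogeneous space, pulled back to the group: the tangent
  vector X at x is moved to the neutral element by left translation with the inverse of x,
  and the tangent space of N at the base point is the (-1)-eigenspace of the involution.
\<close>

definition N_pullback_metric :: "real \<Rightarrow> ghat \<Rightarrow> ghat \<Rightarrow> ghat \<Rightarrow> real" where
  "N_pullback_metric \<kappa> x X Y =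
     (let \<omega> = frechet_derivative (bch \<kappa> (- x)) (at x)
      in lie_product \<kappa> (minus_part (\<omega> X)) (minus_part (\<omega> Y)))"

text \<open>
  A map f on N is smooth iff its composition with the projection is, and a map into N is
  smooth iff it lifts locally to a smooth map into the group. So the following says that f
  is a diffeomorphism from N onto M which pulls the metric h back to the one of N.
\<close>

definition N_isometry_onto ::
    "real \<Rightarrow> 'b::euclidean_space set \<Rightarrow> ('b \<Rightarrow> 'b \<Rightarrow> 'b \<Rightarrow> real) \<Rightarrow> (ghat set \<Rightarrow> 'b) \<Rightarrow> bool" where
  "N_isometry_onto \<kappa> M h f \<longleftrightarrow>
     bij_betw f (N_space \<kappa>) M \<and>
     smooth_on (f \<circ> coset_proj \<kappa>) UNIV \<and>
     (\<forall>p\<in>M. \<exists>U \<tau>. open U \<and> p \<in> U \<and> smooth_on \<tau> U \<and> (\<forall>y\<in>M \<inter> U. f (coset_proj \<kappa> (\<tau> y)) = y)) \<and>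
     (\<forall>x X Y. h (f (coset_proj \<kappa> x))
                (frechet_derivative (f \<circ> coset_proj \<kappa>) (at x) X)
                (frechet_derivative (f \<circ> coset_proj \<kappa>) (at x) Y) = N_pullback_metric \<kappa> x X Y)"

section \<open>N as a complex coordinate space\<close>

text \<open>
  The symmetric bilinear form with quadratic form
  \<open>d\<xi>1 d\<xi>2* + d\<xi>2 d\<xi>1* - \<kappa>/2 |\<xi>2|^2 d\<xi>2 d\<xi>2*\<close>, the star denoting conjugation.
\<close>

definition N_metric ::
    "real \<Rightarrow> complex \<times> complex \<Rightarrow> complex \<times> complex \<Rightarrow> complex \<times> complex \<Rightarrow> real" where
  "N_metric \<kappa> = (\<lambda>(\<xi>1, \<xi>2) (v1, v2) (w1, w2).
     Re (v1 * cnj w2) + Re (v2 * cnj w1) - \<kappa> / 2 * (cmod \<xi>2)\<^sup>2 * Re (v2 * cnj w2))"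

text \<open>
  In the coordinates \<open>v\<close>, \<open>u\<close> of the homogeneous space, \<open>u = e\<close> and
  \<open>v2 - i v1 = s + i \<kappa> a e / 2\<close> for the coset of \<open>(s, a, e)\<close>; then
  \<open>\<xi>1 = v2 - i v1 + \<kappa>/12 |u|^2 u\<close> and \<open>\<xi>2 = u\<close>.
\<close>

definition N_lift_coords :: "real \<Rightarrow> ghat \<Rightarrow> complex \<times> complex" where
  "N_lift_coords \<kappa> = (\<lambda>(s, a, e).
     (s + (\<kappa> / 2 * a) *\<^sub>R (\<i> * e) + (\<kappa> / 12 * (cmod e)\<^sup>2) *\<^sub>R e, e))"

definition N_coords :: "real \<Rightarrow> ghat set \<Rightarrow> complex \<times> complex" where
  "N_coords \<kappa> c = (THE \<xi>. \<exists>x\<in>c. \<xi> = N_lift_coords \<kappa> x)"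

lemma Ck_on_SucD: "Ck_on (Suc k) f UNIV \<Longrightarrow> Ck_on k f UNIV"
proof (induction k arbitrary: f)
  case 0
  then show ?case
    by (auto intro!: continuous_at_imp_continuous_on differentiable_imp_continuous_within)
next
  case (Suc k)
  have "\<And>v. Ck_on (Suc k) (\<lambda>x. frechet_derivative f (at x) v) UNIV"
    using Suc.prems unfolding Ck_on.simps(2)[of "Suc k"] by blast
  then show ?case using Suc.IH Suc.prems by (metis Ck_on.simps(2))
qed

lemma Ck_on_SucI:
  assumes "\<And>x. (f has_derivative f' x) (at x)" and "\<And>v. Ck_on k (\<lambda>x. f' x v) UNIV"
  shows "Ck_on (Suc k) f UNIV"
proof -
  have "frechet_derivative f (at x) = f' x" for x
    using assms(1) by (metis frechet_derivative_at)
  then show ?thesis using assms by (auto simp: differentiable_def)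
qed

lemma Ck_on_SucE:
  assumes "Ck_on (Suc k) f UNIV"
  obtains f' where "\<And>x. (f has_derivative f' x) (at x)" "\<And>v. Ck_on k (\<lambda>x. f' x v) UNIV"
  using assms by (metis Ck_on.simps(2) UNIV_I frechet_derivative_works)

lemma Ck_on_const: "Ck_on k (\<lambda>_. c) UNIV"
proof (induction k arbitrary: c)
  case (Suc k)
  show ?case by (rule Ck_on_SucI[where f' = "\<lambda>_ _. 0"]) (auto intro: Suc.IH)
qed simp

lemma Ck_on_bounded_linear:
  assumes "bounded_linear f" shows "Ck_on k f UNIV"
proof (cases k)
  case 0
  then show ?thesis using assms by (simp add: linear_continuous_on)
next
  case (Suc m)
  then show ?thesis using assms
    by (auto intro!: Ck_on_SucI[where f' = "\<lambda>_. f"] Ck_on_const bounded_linear_imp_has_derivative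
        simp del: Ck_on.simps)
qed

lemma Ck_on_add:
  assumes "Ck_on k f UNIV" "Ck_on k g UNIV" shows "Ck_on k (\<lambda>x. f x + g x) UNIV"
  using assms
proof (induction k arbitrary: f g)
  case (Suc k)
  obtain f' g' where
    "\<And>x. (f has_derivative f' x) (at x)" "\<And>v. Ck_on k (\<lambda>x. f' x v) UNIV"
    "\<And>x. (g has_derivative g' x) (at x)" "\<And>v. Ck_on k (\<lambda>x. g' x v) UNIV"
    using Suc.prems by (metis Ck_on_SucE)
  then show ?case
    by (intro Ck_on_SucI[where f' = "\<lambda>x v. f' x v + g' x v"]) (auto intro: Suc.IH has_derivative_add)
qed (auto intro: continuous_on_add)

lemma Ck_on_bilinear:
  assumes B: "bounded_bilinear B" and "Ck_on k f UNIV" "Ck_on k g UNIV"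
  shows "Ck_on k (\<lambda>x. B (f x) (g x)) UNIV"
  using assms(2-)
proof (induction k arbitrary: f g)
  case 0
  then show ?case using bounded_bilinear.continuous_on[OF B] by auto
next
  case (Suc k)
  obtain f' g' where
    "\<And>x. (f has_derivative f' x) (at x)" "\<And>v. Ck_on k (\<lambda>x. f' x v) UNIV"
    "\<And>x. (g has_derivative g' x) (at x)" "\<And>v. Ck_on k (\<lambda>x. g' x v) UNIV"
    using Suc.prems by (metis Ck_on_SucE)
  moreover have "Ck_on k f UNIV" "Ck_on k g UNIV"
    using Suc.prems Ck_on_SucD by blast+
  ultimately show ?case
    by (intro Ck_on_SucI[where f' = "\<lambda>x v. B (f x) (g' x v) + B (f' x v) (g x)"])
       (auto intro!: Suc.IH Ck_on_add bounded_bilinear.FDERIV[OF B])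
qed

lemma Ck_on_Pair:
  assumes "Ck_on k f UNIV" "Ck_on k g UNIV" shows "Ck_on k (\<lambda>x. (f x, g x)) UNIV"
  using assms
proof (induction k arbitrary: f g)
  case (Suc k)
  obtain f' g' where
    "\<And>x. (f has_derivative f' x) (at x)" "\<And>v. Ck_on k (\<lambda>x. f' x v) UNIV"
    "\<And>x. (g has_derivative g' x) (at x)" "\<And>v. Ck_on k (\<lambda>x. g' x v) UNIV"
    using Suc.prems by (metis Ck_on_SucE)
  then show ?case
    by (intro Ck_on_SucI[where f' = "\<lambda>x v. (f' x v, g' x v)"]) (auto intro: Suc.IH has_derivative_Pair)
qed (auto intro: continuous_on_Pair)

lemmas Ck_on_intros =
  Ck_on_const Ck_on_add Ck_on_Pair
  Ck_on_bilinear[OF bounded_bilinear_scaleR] Ck_on_bilinear[OF bounded_bilinear_mult]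
  Ck_on_bilinear[OF bounded_bilinear_inner]

lemma N_lift_coords_alt:
  "N_lift_coords \<kappa> = (\<lambda>x. (fst x + (\<kappa> / 2 * fst (snd x)) *\<^sub>R (\<i> * snd (snd x))
     + (\<kappa> / 12 * (snd (snd x) \<bullet> snd (snd x))) *\<^sub>R snd (snd x), snd (snd x)))"
  by (auto simp: N_lift_coords_def dot_square_norm)

lemma Ck_on_projections:
  "Ck_on k fst UNIV" "Ck_on k snd UNIV"
  "Ck_on k (\<lambda>x. fst (snd x)) UNIV" "Ck_on k (\<lambda>x. snd (snd x)) UNIV"
  by (rule Ck_on_bounded_linear; intro bounded_linear_intros)+

lemma smooth_N_lift_coords: "smooth_on (N_lift_coords \<kappa>) UNIV"
  unfolding N_lift_coords_alt smooth_on_def by (intro allI Ck_on_intros Ck_on_projections)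

lemma bch_G_plus: "bch \<kappa> (s, a, e) (t *\<^sub>R a0) = (s - (\<kappa> / 2 * t) *\<^sub>R (\<i> * e), a + t, e)"
  by (simp add: bch_def lie_bracket_def \<sigma>1_def \<sigma>2_def a0_def complex_eq_iff)

lemma N_lift_coords_eq_iff: "N_lift_coords \<kappa> x = N_lift_coords \<kappa> y \<longleftrightarrow> y \<in> coset_proj \<kappa> x"
proof (cases x; cases y)
  fix s a e s' a' e' assume [simp]: "x = (s, a, e)" "y = (s', a', e')"
  have "y \<in> coset_proj \<kappa> x \<longleftrightarrow> (\<exists>t. y = bch \<kappa> x (t *\<^sub>R a0))"
    by (auto simp: coset_proj_def G_plus_def)
  also have "\<dots> \<longleftrightarrow> s' = s - (\<kappa> / 2 * (a' - a)) *\<^sub>R (\<i> * e) \<and> e' = e"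
    by (auto simp: bch_G_plus intro!: exI[of _ "a' - a"])
  also have "\<dots> \<longleftrightarrow> N_lift_coords \<kappa> x = N_lift_coords \<kappa> y"
    by (auto simp: N_lift_coords_def complex_eq_iff cmod_power2 field_simps)
  finally show ?thesis by simp
qed

lemma coset_proj_eq_iff: "coset_proj \<kappa> x = coset_proj \<kappa> y \<longleftrightarrow> N_lift_coords \<kappa> x = N_lift_coords \<kappa> y"
  by (metis N_lift_coords_eq_iff subset_antisym subsetI)

lemma N_coords_coset_proj: "N_coords \<kappa> (coset_proj \<kappa> x) = N_lift_coords \<kappa> x"
  unfolding N_coords_def by (rule the_equality) (metis N_lift_coords_eq_iff)+

lemma bounded_bilinear_lie_bracket: "bounded_bilinear (lie_bracket \<kappa>)"
proof -
  have "bilinear (lie_bracket \<kappa>)"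
    by (auto simp: bilinear_def lie_bracket_def \<sigma>1_def \<sigma>2_def a0_def complex_eq_iff
        algebra_simps intro!: linearI split: prod.splits)
  then show ?thesis by (simp add: bilinear_conv_bounded_bilinear)
qed

lemma bch_left_translation_derivative:
  "frechet_derivative (bch \<kappa> (- x)) (at x) =
     (\<lambda>X. X - (1/2) *\<^sub>R lie_bracket \<kappa> x X + (1/6) *\<^sub>R lie_bracket \<kappa> x (lie_bracket \<kappa> x X))"
proof -
  interpret L: bounded_bilinear "lie_bracket \<kappa>" by (rule bounded_bilinear_lie_bracket)
  have anti: "lie_bracket \<kappa> Y Z = - lie_bracket \<kappa> Z Y" for Y Z
    by (rule lie_bracket_basis(6))
  have self: "lie_bracket \<kappa> x x = 0"
    by (cases x) (simp add: lie_bracket_def zero_prod_def)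
  have "((\<lambda>y. - x + y + (1/2) *\<^sub>R lie_bracket \<kappa> (- x) y
     + (1/12) *\<^sub>R (lie_bracket \<kappa> (- x) (lie_bracket \<kappa> (- x) y) + lie_bracket \<kappa> y (lie_bracket \<kappa> y (- x))))
     has_derivative (\<lambda>X. X + (1/2) *\<^sub>R lie_bracket \<kappa> (- x) X
     + (1/12) *\<^sub>R (lie_bracket \<kappa> (- x) (lie_bracket \<kappa> (- x) X)
        + (lie_bracket \<kappa> x (lie_bracket \<kappa> X (- x)) + lie_bracket \<kappa> X (lie_bracket \<kappa> x (- x)))))) (at x)"
    by (auto intro!: derivative_eq_intros L.FDERIV simp: L.zero_left L.zero_right)
  then have "frechet_derivative (bch \<kappa> (- x)) (at x) = (\<lambda>X. X + (1/2) *\<^sub>R lie_bracket \<kappa> (- x) X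
     + (1/12) *\<^sub>R (lie_bracket \<kappa> (- x) (lie_bracket \<kappa> (- x) X)
        + (lie_bracket \<kappa> x (lie_bracket \<kappa> X (- x)) + lie_bracket \<kappa> X (lie_bracket \<kappa> x (- x)))))"
    unfolding bch_def[abs_def] by (rule frechet_derivative_at[symmetric])
  also have "\<dots> = (\<lambda>X. X - (1/2) *\<^sub>R lie_bracket \<kappa> x X + (1/6) *\<^sub>R lie_bracket \<kappa> x (lie_bracket \<kappa> x X))"
  proof
    fix X
    have "lie_bracket \<kappa> X (- x) = lie_bracket \<kappa> x X"
      by (subst anti) (simp add: L.minus_left)
    then show "X + (1/2) *\<^sub>R lie_bracket \<kappa> (- x) X
     + (1/12) *\<^sub>R (lie_bracket \<kappa> (- x) (lie_bracket \<kappa> (- x) X)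
        + (lie_bracket \<kappa> x (lie_bracket \<kappa> X (- x)) + lie_bracket \<kappa> X (lie_bracket \<kappa> x (- x))))
      = X - (1/2) *\<^sub>R lie_bracket \<kappa> x X + (1/6) *\<^sub>R lie_bracket \<kappa> x (lie_bracket \<kappa> x X)"
      by (simp add: L.minus_left L.minus_right self L.zero_right flip: scaleR_2)
  qed
  finally show ?thesis .
qed

lemma N_lift_coords_derivative:
  "frechet_derivative (N_lift_coords \<kappa>) (at (s, a, e)) = (\<lambda>(S, A, E).
     (S + (\<kappa> / 2 * a) *\<^sub>R (\<i> * E) + (\<kappa> / 2 * A) *\<^sub>R (\<i> * e)
      + (\<kappa> / 12 * (e \<bullet> e)) *\<^sub>R E + (\<kappa> / 6 * (e \<bullet> E)) *\<^sub>R e, E))"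
proof (rule frechet_derivative_at[symmetric])
  show "(N_lift_coords \<kappa> has_derivative (\<lambda>(S, A, E).
     (S + (\<kappa> / 2 * a) *\<^sub>R (\<i> * E) + (\<kappa> / 2 * A) *\<^sub>R (\<i> * e)
      + (\<kappa> / 12 * (e \<bullet> e)) *\<^sub>R E + (\<kappa> / 6 * (e \<bullet> E)) *\<^sub>R e, E))) (at (s, a, e))"
    unfolding N_lift_coords_alt
    by (auto intro!: derivative_eq_intros simp: fun_eq_iff complex_eq_iff inner_complex_def field_simps)
qed

text \<open>The coordinates identify the homogeneous space N isometrically with \<open>complex \<times> complex\<close>
  carrying the metric \<open>N_metric\<close>.\<close>

lemma N_coords_isometry: "N_isometry_onto \<kappa> UNIV (N_metric \<kappa>) (N_coords \<kappa>)"
proof -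
  define \<tau> :: "complex \<times> complex \<Rightarrow> ghat"
    where "\<tau> = (\<lambda>\<xi>. (fst \<xi> + (- \<kappa> / 12 * (snd \<xi> \<bullet> snd \<xi>)) *\<^sub>R snd \<xi>, 0, snd \<xi>))"
  have \<tau>: "N_coords \<kappa> (coset_proj \<kappa> (\<tau> \<xi>)) = \<xi>" for \<xi>
    by (cases \<xi>) (simp add: N_coords_coset_proj N_lift_coords_alt \<tau>_def)
  have smooth: "smooth_on \<tau> UNIV"
    unfolding \<tau>_def smooth_on_def by (intro allI Ck_on_intros Ck_on_projections)
  have comp: "N_coords \<kappa> \<circ> coset_proj \<kappa> = N_lift_coords \<kappa>"
    by (auto simp: N_coords_coset_proj)
  have "bij_betw (N_coords \<kappa>) (N_space \<kappa>) UNIV"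
    unfolding bij_betw_def inj_on_def N_space_def
    by (auto simp: N_coords_coset_proj coset_proj_eq_iff image_image) (metis \<tau> N_coords_coset_proj rangeI)
  moreover have "N_metric \<kappa> (N_lift_coords \<kappa> x)
      (frechet_derivative (N_lift_coords \<kappa>) (at x) X)
      (frechet_derivative (N_lift_coords \<kappa>) (at x) Y) = N_pullback_metric \<kappa> x X Y" for x X Y
  proof -
    obtain s a e S A E S' A' E' where c: "x = (s, a, e)" "X = (S, A, E)" "Y = (S', A', E')"
      by (metis prod.exhaust)
    show ?thesis
      unfolding c N_lift_coords_derivative N_pullback_metric_def bch_left_translation_derivative Let_def
      by (simp add: N_lift_coords_def N_metric_def lie_product_def minus_part_def lie_involution_def
            lie_bracket_def \<sigma>1_def \<sigma>2_def a0_def inner_complex_def cmod_power2)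
         (simp add: field_simps power2_eq_square)
  qed
  moreover have "\<exists>U \<tau>. open U \<and> p \<in> U \<and> smooth_on \<tau> U \<and>
      (\<forall>y\<in>UNIV \<inter> U. N_coords \<kappa> (coset_proj \<kappa> (\<tau> y)) = y)" for p
    using \<tau> smooth by (intro exI[of _ UNIV] exI[of _ \<tau>]) auto
  ultimately show ?thesis
    unfolding N_isometry_onto_def comp by (auto simp: N_coords_coset_proj smooth_N_lift_coords)
qed

section \<open>The extrinsic symmetric space\<close>

type_synonym ambient = "complex \<times> real \<times> complex"

text \<open>The symmetric bilinear form with quadratic form \<open>d\<eta>1 d\<eta>2* + d\<eta>1* d\<eta>2 + \<kappa> dx^2\<close>.\<close>

definition ambient_product :: "real \<Rightarrow> ambient \<Rightarrow> ambient \<Rightarrow> real" where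
  "ambient_product \<kappa> = (\<lambda>(v1, x, v2) (w1, y, w2).
     Re (v1 * cnj w2) + Re (v2 * cnj w1) + \<kappa> * x * y)"

definition ext_space :: "ambient set" where
  "ext_space = {(\<eta>1, - (1/2) * (cmod \<eta>2)\<^sup>2, \<eta>2) | \<eta>1 \<eta>2. True}"

definition iota :: "real \<Rightarrow> complex \<times> complex \<Rightarrow> ambient" where
  "iota \<kappa> = (\<lambda>(\<xi>1, \<xi>2).
     (\<xi>1 - complex_of_real (\<kappa> / 4 * (cmod \<xi>2)\<^sup>2) * \<xi>2, - (1/2) * (cmod \<xi>2)\<^sup>2, \<xi>2))"

definition to_R2 :: "complex \<Rightarrow> real^2" where
  "to_R2 z = vector [Re z, Im z]"

definition of_R2 :: "real^2 \<Rightarrow> complex" where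
  "of_R2 v = Complex (v $ 1) (v $ 2)"

text \<open>
  The affine map of the augmented matrix with rows \<open>(A11, a12, A13 | b1)\<close>,
  \<open>(a21, a22, a23 | b2)\<close>, \<open>(A31, a32, A33 | b3)\<close>; the row vectors a21 and a23 act through the
  inner product.
\<close>

definition block_affine ::
    "real^2^2 \<Rightarrow> real^2 \<Rightarrow> real^2^2 \<Rightarrow> real^2 \<Rightarrow>
     real^2 \<Rightarrow> real \<Rightarrow> real^2 \<Rightarrow> real \<Rightarrow>
     real^2^2 \<Rightarrow> real^2 \<Rightarrow> real^2^2 \<Rightarrow> real^2 \<Rightarrow> ambient \<Rightarrow> ambient" where
  "block_affine A11 a12 A13 b1 a21 a22 a23 b2 A31 a32 A33 b3 = (\<lambda>(\<eta>1, x, \<eta>2).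
     (of_R2 (A11 *v to_R2 \<eta>1 + x *\<^sub>R a12 + A13 *v to_R2 \<eta>2 + b1),
      a21 \<bullet> to_R2 \<eta>1 + a22 * x + a23 \<bullet> to_R2 \<eta>2 + b2,
      of_R2 (A31 *v to_R2 \<eta>1 + x *\<^sub>R a32 + A33 *v to_R2 \<eta>2 + b3)))"

definition Ghat_matrices :: "real \<Rightarrow> (ambient \<Rightarrow> ambient) set" where
  "Ghat_matrices \<kappa> =
     {block_affine
        (mat 1) (\<kappa> *\<^sub>R X) ((- \<kappa> / 2) *\<^sub>R ((columnvector X :: real^1^2) ** (rowvector X :: real^2^1)) + Y) Z
        0       1         (- X)                                                                       (- (1/2) * (X \<bullet> X))
        0       0         (mat 1)                                                                     X
      | X Z Y. \<exists>y. Y = vector [vector [0, - y], vector [y, 0]]}"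

definition O2 :: "(ambient \<Rightarrow> ambient) set" where
  "O2 = {block_affine S 0 0 0
                      0 1 0 0
                      0 0 S 0 | S. orthogonal_matrix S}"

text \<open>Determinants of linear endomorphisms of the ambient space, by its standard real basis.\<close>

definition to_vec :: "ambient \<Rightarrow> real^(2 + 1 + 2)" where
  "to_vec = (\<lambda>(\<eta>1, x, \<eta>2).
     (\<chi> i. case i of Inl j \<Rightarrow> to_R2 \<eta>1 $ j | Inr (Inl _) \<Rightarrow> x | Inr (Inr k) \<Rightarrow> to_R2 \<eta>2 $ k))"

definition of_vec :: "real^(2 + 1 + 2) \<Rightarrow> ambient" where
  "of_vec w = (of_R2 (\<chi> j. w $ Inl j), w $ Inr (Inl 1), of_R2 (\<chi> k. w $ Inr (Inr k)))"

definition special_isometries :: "real \<Rightarrow> (ambient \<Rightarrow> ambient) set" where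
  "special_isometries \<kappa> =
     {A \<in> linear_isometries (ambient_product \<kappa>). det (matrix (to_vec \<circ> A \<circ> of_vec)) = 1}"

end

theory Submission
  imports Defs
begin

text \<open>
  The extrinsic reflections are explicit affine maps, and the composition of two of them lies in the
  matrix group; conversely, the reflection in 0 followed by another reflection realizes every matrix
  with y = 0, and products of these supply y. Since iota is an isometry onto M, conjugating with it
  turns the extrinsic reflections into point symmetries of N. That there are no other point
  symmetries is the rigidity of isometries: an isometry preserves geodesics, any two points of N are
  joined by a geodesic, and a geodesic is determined by its initial data, because its equation says
  that the second coordinate is affine and then gives the second derivative of the first one. For
  the extrinsic isometries, transitivity of the matrix group on M reduces to linear maps; these
  preserve the largest linear subspace contained in M and its orthogonal complement, which leaves
  diag(S,1,S) times a matrix with X = Z = 0.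
\<close>

section \<open>Smooth maps\<close>

text \<open>A point symmetry is only known to be a smooth isometry with prescribed value and
  derivative at one point, so the transvections of N cannot be computed before such a map is shown
  to be unique. The metric is indefinite and offers no distance to argue with; the invariance of the
  geodesic equation rests on the symmetry of second derivatives, which is therefore derived from the
  mean value theorem. The geodesic equation is kept with its index lowered and tested against all
  vectors, so the metric is never inverted. On N the geodesics are at most cubic in time and exist
  for all times, so elementary integration replaces a general theory of differential equations. On
  the group side, a product of two reflections one of which is the reflection in 0 always has y = 0.
  The parameter y arises in further products as \<kappa> times a signed area spanned by the X parts,
  and reaching every y is where \<kappa> \<noteq> 0 enters the generation of the matrix
  group.\<close>

lemma has_field_derivative_along_line:
  fixes f :: "'a::real_normed_vector \<Rightarrow> real"
  assumes "(f has_derivative f') (at (x + s *\<^sub>R u))"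
  shows "((\<lambda>s. f (x + s *\<^sub>R u)) has_field_derivative f' u) (at s)"
proof -
  have "((\<lambda>s. f (x + s *\<^sub>R u)) has_derivative (\<lambda>r. f' (r *\<^sub>R u))) (at s)"
    by (rule has_derivative_compose[of "\<lambda>s. x + s *\<^sub>R u", OF _ assms]) (auto intro!: derivative_eq_intros)
  moreover have "f' (r *\<^sub>R u) = r * f' u" for r
    using linear_scale[OF has_derivative_linear[OF assms]] by simp
  ultimately show ?thesis
    by (simp add: has_field_derivative_def mult.commute[of _ "f' u"])
qed

text \<open>Two applications of the mean value theorem: the increment along \<open>v\<close> is a
  function of the step along \<open>u\<close>, and the increment of its derivative is again a mean
  value along \<open>v\<close>. The left side does not change when \<open>u\<close> and
  \<open>v\<close> are exchanged, which is what makes it useful.\<close>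

lemma second_difference_mean_value:
  fixes f :: "'a::real_normed_vector \<Rightarrow> real"
  assumes f: "\<And>x. (f has_derivative f' x) (at x)"
    and f': "\<And>x. ((\<lambda>x. f' x u) has_derivative f'' x) (at x)" and "h > 0"
  shows "\<exists>s t. 0 < s \<and> s < h \<and> 0 < t \<and> t < h \<and>
    f (x + h *\<^sub>R u + h *\<^sub>R v) - f (x + h *\<^sub>R u) - f (x + h *\<^sub>R v) + f x
      = h * h * f'' (x + s *\<^sub>R u + t *\<^sub>R v) v"
proof -
  have "((\<lambda>s. f ((x + h *\<^sub>R v) + s *\<^sub>R u) - f (x + s *\<^sub>R u)) has_field_derivative
      f' ((x + h *\<^sub>R v) + s *\<^sub>R u) u - f' (x + s *\<^sub>R u) u) (at s)" for s
    by (intro DERIV_diff has_field_derivative_along_line f)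
  from MVT2[OF \<open>h > 0\<close> this] obtain s where s: "0 < s" "s < h"
    and 1: "f (x + h *\<^sub>R v + h *\<^sub>R u) - f (x + h *\<^sub>R u) - (f (x + h *\<^sub>R v) - f x)
      = h * (f' (x + h *\<^sub>R v + s *\<^sub>R u) u - f' (x + s *\<^sub>R u) u)"
    by auto
  have "((\<lambda>t. f' (x + s *\<^sub>R u + t *\<^sub>R v) u) has_field_derivative f'' (x + s *\<^sub>R u + t *\<^sub>R v) v) (at t)" for t
    by (intro has_field_derivative_along_line f')
  from MVT2[OF \<open>h > 0\<close> this] obtain t where t: "0 < t" "t < h"
    and 2: "f' (x + s *\<^sub>R u + h *\<^sub>R v) u - f' (x + s *\<^sub>R u) u = h * f'' (x + s *\<^sub>R u + t *\<^sub>R v) v"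
    by auto
  have "x + h *\<^sub>R v + s *\<^sub>R u = x + s *\<^sub>R u + h *\<^sub>R v"
    "x + h *\<^sub>R v + h *\<^sub>R u = x + h *\<^sub>R u + h *\<^sub>R v"
    by (simp_all add: algebra_simps)
  with 1 2 have "f (x + h *\<^sub>R u + h *\<^sub>R v) - f (x + h *\<^sub>R u) - f (x + h *\<^sub>R v) + f x
      = h * h * f'' (x + s *\<^sub>R u + t *\<^sub>R v) v"
    by (simp add: algebra_simps)
  with s t show ?thesis by blast
qed

text \<open>Schwarz's theorem. The second difference with step \<open>h n\<close> is symmetric in
  \<open>u\<close> and \<open>v\<close>; divided by the square of the step it is a value of either
  mixed derivative at a point tending to \<open>x\<close>, and continuity makes the limits
  agree.\<close>

lemma symmetric_second_derivative_real:
  fixes f :: "'a::real_normed_vector \<Rightarrow> real"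
  assumes f: "\<And>x. (f has_derivative f' x) (at x)"
    and u: "\<And>x. ((\<lambda>x. f' x u) has_derivative fu x) (at x)"
    and v: "\<And>x. ((\<lambda>x. f' x v) has_derivative fv x) (at x)"
    and cont: "continuous_on UNIV (\<lambda>x. fu x v)" "continuous_on UNIV (\<lambda>x. fv x u)"
  shows "fu x v = fv x u"
proof -
  define h :: "nat \<Rightarrow> real" where "h n = inverse (Suc n)" for n
  have h: "h n > 0" for n by (simp add: h_def)
  have h0: "h \<longlonglongrightarrow> 0"
    unfolding h_def by (rule LIMSEQ_inverse_real_of_nat)
  have lim: "(\<lambda>n. k (x + s n *\<^sub>R a + t n *\<^sub>R b)) \<longlonglongrightarrow> k x"
    if "\<And>n. 0 < s n \<and> s n < h n" "\<And>n. 0 < t n \<and> t n < h n" "continuous_on UNIV k"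
    for s t :: "nat \<Rightarrow> real" and a b :: 'a and k :: "'a \<Rightarrow> real"
  proof -
    have "s \<longlonglongrightarrow> 0" "t \<longlonglongrightarrow> 0"
      using that by (auto intro!: tendsto_sandwich[OF _ _ tendsto_const h0] always_eventually less_imp_le)
    then have "(\<lambda>n. x + s n *\<^sub>R a + t n *\<^sub>R b) \<longlonglongrightarrow> x + 0 *\<^sub>R a + 0 *\<^sub>R b"
      by (intro tendsto_intros)
    then have "(\<lambda>n. x + s n *\<^sub>R a + t n *\<^sub>R b) \<longlonglongrightarrow> x" by simp
    moreover have "isCont k x"
      using that(3) by (simp add: continuous_on_eq_continuous_at)
    ultimately show ?thesis by (rule isCont_tendsto_compose[rotated])
  qed
  obtain s t where 1: "\<And>n. 0 < s n \<and> s n < h n" "\<And>n. 0 < t n \<and> t n < h n"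
    "\<And>n. f (x + h n *\<^sub>R u + h n *\<^sub>R v) - f (x + h n *\<^sub>R u) - f (x + h n *\<^sub>R v) + f x
      = h n * h n * fu (x + s n *\<^sub>R u + t n *\<^sub>R v) v"
    using second_difference_mean_value[OF f u h, where x = x and v = v] by metis
  obtain s' t' where 2: "\<And>n. 0 < s' n \<and> s' n < h n" "\<And>n. 0 < t' n \<and> t' n < h n"
    "\<And>n. f (x + h n *\<^sub>R v + h n *\<^sub>R u) - f (x + h n *\<^sub>R v) - f (x + h n *\<^sub>R u) + f x
      = h n * h n * fv (x + s' n *\<^sub>R v + t' n *\<^sub>R u) u"
    using second_difference_mean_value[OF f v h, where x = x and v = u] by metis
  have "fu (x + s n *\<^sub>R u + t n *\<^sub>R v) v = fv (x + s' n *\<^sub>R v + t' n *\<^sub>R u) u" for n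
  proof -
    have swap: "x + h n *\<^sub>R v + h n *\<^sub>R u = x + h n *\<^sub>R u + h n *\<^sub>R v" by simp
    have "h n * h n * fu (x + s n *\<^sub>R u + t n *\<^sub>R v) v = h n * h n * fv (x + s' n *\<^sub>R v + t' n *\<^sub>R u) u"
      using 1(3)[of n] 2(3)[of n] unfolding swap by linarith
    then show ?thesis using h[of n] by simp
  qed
  moreover have "(\<lambda>n. fu (x + s n *\<^sub>R u + t n *\<^sub>R v) v) \<longlonglongrightarrow> fu x v"
    by (rule lim[OF 1(1,2) cont(1)])
  moreover have "(\<lambda>n. fv (x + s' n *\<^sub>R v + t' n *\<^sub>R u) u) \<longlonglongrightarrow> fv x u"
    by (rule lim[OF 2(1,2) cont(2)])
  ultimately show ?thesis by (simp add: LIMSEQ_unique)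
qed

lemma smooth_on_frechet_derivative:
  assumes "smooth_on f UNIV"
  shows "(f has_derivative frechet_derivative f (at x)) (at x)"
    and "smooth_on (\<lambda>x. frechet_derivative f (at x) v) UNIV"
proof -
  have *: "Ck_on (Suc k) f UNIV" for k
    using assms by (simp add: smooth_on_def del: Ck_on.simps)
  show "(f has_derivative frechet_derivative f (at x)) (at x)"
    using *[of 0] by (simp add: frechet_derivative_works)
  show "smooth_on (\<lambda>x. frechet_derivative f (at x) v) UNIV"
    using * by (simp add: smooth_on_def)
qed

lemma smooth_on_continuous_on: "smooth_on f UNIV \<Longrightarrow> continuous_on UNIV f"
  by (metis Ck_on.simps(1) smooth_on_def)

text \<open>Pairing with a fixed vector \<open>b\<close> reduces this to real-valued
  functions.\<close>

lemma symmetric_second_derivative: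
  fixes f :: "'a::real_normed_vector \<Rightarrow> 'b::real_inner"
  assumes f: "smooth_on f UNIV"
  shows "frechet_derivative (\<lambda>x. frechet_derivative f (at x) u) (at x) v
    = frechet_derivative (\<lambda>x. frechet_derivative f (at x) v) (at x) u"
proof -
  let ?D = "\<lambda>x. frechet_derivative f (at x)"
  have "frechet_derivative (\<lambda>x. ?D x u) (at x) v \<bullet> b = frechet_derivative (\<lambda>x. ?D x v) (at x) u \<bullet> b" for b
    by (rule symmetric_second_derivative_real[of "\<lambda>x. f x \<bullet> b" "\<lambda>x v. ?D x v \<bullet> b" u
          "\<lambda>x v. frechet_derivative (\<lambda>x. ?D x u) (at x) v \<bullet> b" v
          "\<lambda>x u. frechet_derivative (\<lambda>x. ?D x v) (at x) u \<bullet> b"])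
      (rule has_derivative_inner_left continuous_on_inner continuous_on_const
        smooth_on_continuous_on smooth_on_frechet_derivative f)+
  then show ?thesis by (metis inner_commute vector_eq_rdot)
qed

section \<open>Composition of smooth maps\<close>

lemma Ck_on_sum:
  assumes "finite I" "\<And>i. i \<in> I \<Longrightarrow> Ck_on k (f i) UNIV"
  shows "Ck_on k (\<lambda>x. \<Sum>i\<in>I. f i x) UNIV"
  using assms by (induction rule: finite_induct) (auto intro: Ck_on_const Ck_on_add)

lemma linear_euclidean_expansion:
  fixes v :: "'a::euclidean_space"
  assumes "linear f"
  shows "f v = (\<Sum>b\<in>Basis. (v \<bullet> b) *\<^sub>R f b)"
proof -
  have "f v = f (\<Sum>b\<in>Basis. (v \<bullet> b) *\<^sub>R b)" by (simp add: euclidean_representation)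
  then show ?thesis by (simp add: linear_sum[OF assms] linear_scale[OF assms])
qed

lemma Ck_on_compose:
  fixes g :: "'a::real_normed_vector \<Rightarrow> 'b::euclidean_space"
  assumes "Ck_on k f UNIV" "Ck_on k g UNIV" shows "Ck_on k (\<lambda>x. f (g x)) UNIV"
  using assms
proof (induction k arbitrary: f)
  case 0
  then show ?case by (auto intro: continuous_on_compose2)
next
  case (Suc k)
  obtain f' g' where
    f': "\<And>x. (f has_derivative f' x) (at x)" "\<And>v. Ck_on k (\<lambda>x. f' x v) UNIV" and
    g': "\<And>x. (g has_derivative g' x) (at x)" "\<And>v. Ck_on k (\<lambda>x. g' x v) UNIV"
    using Suc.prems by (metis Ck_on_SucE)
  \<comment> \<open>\<open>f'\<close> depends on a point and a direction, and both vary with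
    \<open>x\<close>. Expanding the direction in the basis leaves coordinates of
    \<open>g' x v\<close> times directional derivatives of \<open>f\<close> along fixed vectors, to
    which the induction hypothesis applies.\<close>
  have "f' (g x) (g' x v) = (\<Sum>b\<in>Basis. (g' x v \<bullet> b) *\<^sub>R f' (g x) b)" for x v
    by (rule linear_euclidean_expansion[OF has_derivative_linear[OF f'(1)]])
  then have "Ck_on k (\<lambda>x. f' (g x) (g' x v)) UNIV \<longleftrightarrow> Ck_on k (\<lambda>x. \<Sum>b\<in>Basis. (g' x v \<bullet> b) *\<^sub>R f' (g x) b) UNIV" for v
    by presburger
  moreover have "Ck_on k (\<lambda>x. \<Sum>b\<in>Basis. (g' x v \<bullet> b) *\<^sub>R f' (g x) b) UNIV" for v
    using Suc.IH[OF f'(2)] Ck_on_SucD[OF Suc.prems(2)] g'(2)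
    by (intro Ck_on_sum Ck_on_intros) auto
  ultimately show ?case
    by (intro Ck_on_SucI[where f' = "\<lambda>x v. f' (g x) (g' x v)"])
      (auto intro: has_derivative_compose f' g')
qed

lemma smooth_on_compose:
  fixes g :: "'a::real_normed_vector \<Rightarrow> 'b::euclidean_space"
  shows "smooth_on f UNIV \<Longrightarrow> smooth_on g UNIV \<Longrightarrow> smooth_on (f \<circ> g) UNIV"
  by (simp add: smooth_on_def o_def Ck_on_compose)

section \<open>Geodesics and rigidity of isometries\<close>

text \<open>\<open>g' x u v w\<close> is the derivative of \<open>g x v w\<close> in the point
  \<open>x\<close> along \<open>u\<close>. Differentiability is required jointly in the point and
  the two vectors, because under a map all three move at once.\<close>

locale metric_field =
  fixes g :: "'a::euclidean_space \<Rightarrow> 'a \<Rightarrow> 'a \<Rightarrow> real" and g' :: "'a \<Rightarrow> 'a \<Rightarrow> 'a \<Rightarrow> 'a \<Rightarrow> real"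
  assumes symmetric: "g x v w = g x w v"
    and linear_metric: "linear (\<lambda>v. g x v w)"
    and has_derivative_metric: "((\<lambda>(x, v, w). g x v w) has_derivative
      (\<lambda>(u, v', w'). g' x u v w + g x v' w + g x v w')) (at (x, v, w))"
    and nondegenerate: "(\<And>w. g x v w = 0) \<Longrightarrow> v = 0"
begin

text \<open>The Christoffel symbol of the first kind, with \<open>v\<close> in both symmetric slots
  and \<open>w\<close> paired with the lowered index.\<close>

definition christoffel :: "'a \<Rightarrow> 'a \<Rightarrow> 'a \<Rightarrow> real" where
  "christoffel x v w = g' x v v w - g' x w v v / 2"

definition geodesic :: "(real \<Rightarrow> 'a) \<Rightarrow> (real \<Rightarrow> 'a) \<Rightarrow> (real \<Rightarrow> 'a) \<Rightarrow> bool" where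
  "geodesic \<gamma> \<gamma>' \<gamma>'' \<longleftrightarrow>
     (\<forall>t. (\<gamma> has_vector_derivative \<gamma>' t) (at t) \<and> (\<gamma>' has_vector_derivative \<gamma>'' t) (at t) \<and>
       (\<forall>w. g (\<gamma> t) (\<gamma>'' t) w + christoffel (\<gamma> t) (\<gamma>' t) w = 0))"

definition local_isometry :: "('a \<Rightarrow> 'a) \<Rightarrow> bool" where
  "local_isometry f \<longleftrightarrow> smooth_on f UNIV \<and>
     (\<forall>x v w. g (f x) (frechet_derivative f (at x) v) (frechet_derivative f (at x) w) = g x v w)"

lemmas metric_add = linear_add[OF linear_metric] and metric_diff = linear_diff[OF linear_metric]
  and metric_zero = linear_0[OF linear_metric]

text \<open>A vector killed by the derivative is orthogonal to everything, so nondegeneracy makes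
  the derivative injective. Surjectivity lets the lowered geodesic equation at an image point be
  tested on image vectors alone.\<close>

lemma local_isometry_derivative_surj:
  assumes "local_isometry f"
  shows "surj (frechet_derivative f (at x))"
proof -
  let ?A = "frechet_derivative f (at x)"
  have lin: "linear ?A"
    using assms smooth_on_frechet_derivative(1) has_derivative_linear unfolding local_isometry_def by blast
  have "v = 0" if "?A v = 0" for v
  proof (rule nondegenerate)
    have "g x v w = g (f x) (?A v) (?A w)" for w
      using assms by (simp add: local_isometry_def)
    then show "g x v w = 0" for w by (simp add: that metric_zero)
  qed
  then show ?thesis
    using lin by (simp add: linear_injective_0 linear_injective_imp_surjective)
qed

text \<open>The combination of derivatives of the metric that isolates the second derivative is the one
  which yields the Levi-Civita connection in Koszul's formula.\<close>

lemma local_isometry_second_derivative: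
  assumes "local_isometry f"
  defines "D \<equiv> \<lambda>v x. frechet_derivative f (at x) v"
  shows "g (f x) (frechet_derivative (D v) (at x) v) (D w x)
    = christoffel x v w - christoffel (f x) (D v x) (D w x)"
proof -
  let ?DD = "\<lambda>v x u. frechet_derivative (D v) (at x) u"
  have f: "smooth_on f UNIV" and iso: "g (f x) (D v x) (D w x) = g x v w" for x v w
    using assms by (auto simp: local_isometry_def)
  have D: "((\<lambda>x. D v x) has_derivative ?DD v x) (at x)" for v x
    unfolding D_def by (intro smooth_on_frechet_derivative f)
  \<comment> \<open>\<open>g (f x) (D v x) (D w x)\<close> equals \<open>g x v w\<close>; its
    derivative along \<open>u\<close> is computed once from each form.\<close>
  have key: "g' (f x) (D u x) (D v x) (D w x) + g (f x) (?DD v x u) (D w x) + g (f x) (D v x) (?DD w x u)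
      = g' x u v w" for u v w
  proof -
    have "((\<lambda>x. (f x, D v x, D w x)) has_derivative (\<lambda>u. (D u x, ?DD v x u, ?DD w x u))) (at x)"
      by (rule has_derivative_Pair[OF _ has_derivative_Pair[OF D D]])
        (simp add: D_def smooth_on_frechet_derivative(1)[OF f])
    from has_derivative_compose[OF this has_derivative_metric]
    have "((\<lambda>x. g (f x) (D v x) (D w x)) has_derivative (\<lambda>u. g' (f x) (D u x) (D v x) (D w x)
        + g (f x) (?DD v x u) (D w x) + g (f x) (D v x) (?DD w x u))) (at x)" by simp
    then have 1: "((\<lambda>x. g x v w) has_derivative (\<lambda>u. g' (f x) (D u x) (D v x) (D w x)
        + g (f x) (?DD v x u) (D w x) + g (f x) (D v x) (?DD w x u))) (at x)"
      by (simp only: iso)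
    have "((\<lambda>x. (x, v, w)) has_derivative (\<lambda>u. (u, 0, 0))) (at x)"
      by (intro has_derivative_Pair has_derivative_const has_derivative_ident)
    from has_derivative_compose[OF this has_derivative_metric]
    have "((\<lambda>x. g x v w) has_derivative (\<lambda>u. g' x u v w)) (at x)"
      by (simp add: metric_zero symmetric[of _ v 0])
    from has_derivative_unique[OF 1 this] show ?thesis by (rule fun_cong)
  qed
  \<comment> \<open>This symmetry cancels the unwanted terms in \<open>key[of v v w]\<close> minus
    half of \<open>key[of w v v]\<close>.\<close>
  have "?DD w x v = ?DD v x w"
    unfolding D_def by (rule symmetric_second_derivative[OF f])
  with key[of v v w] key[of w v v] symmetric[of "f x" "D v x" "?DD v x w"] show ?thesis
    by (simp add: christoffel_def)
qed

lemma has_vector_derivative_along_curve: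
  fixes F :: "'a \<Rightarrow> 'c::real_normed_vector"
  assumes "(F has_derivative F') (at (\<gamma> t))" "(\<gamma> has_vector_derivative v) (at t)"
  shows "((\<lambda>t. F (\<gamma> t)) has_vector_derivative F' v) (at t)"
  using vector_derivative_diff_chain_within[of \<gamma> v t UNIV F F'] assms
  by (simp add: o_def has_derivative_at_withinI)

text \<open>The acceleration of the image curve is the second derivative of \<open>f\<close> on the
  velocity plus the first derivative on the acceleration. Paired with an image vector, the former
  exchanges the Christoffel terms at the two points, and the latter completes the geodesic equation
  of the given curve.\<close>

lemma local_isometry_geodesic:
  assumes iso: "local_isometry f" and geo: "geodesic \<gamma> \<gamma>' \<gamma>''"
  shows "\<exists>\<delta>. geodesic (f \<circ> \<gamma>) (\<lambda>t. frechet_derivative f (at (\<gamma> t)) (\<gamma>' t)) \<delta>"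
proof -
  define D where "D = (\<lambda>v x. frechet_derivative f (at x) v)"
  let ?DD = "\<lambda>v x u. frechet_derivative (D v) (at x) u"
  define \<delta> where "\<delta> = (\<lambda>t. ?DD (\<gamma>' t) (\<gamma> t) (\<gamma>' t) + D (\<gamma>'' t) (\<gamma> t))"
  have f: "smooth_on f UNIV" and \<gamma>: "(\<gamma> has_vector_derivative \<gamma>' t) (at t)"
    and \<gamma>': "(\<gamma>' has_vector_derivative \<gamma>'' t) (at t)" for t
    using iso geo by (auto simp: local_isometry_def geodesic_def)
  have D: "((\<lambda>x. D v x) has_derivative ?DD v x) (at x)" for v x
    unfolding D_def by (intro smooth_on_frechet_derivative f)
  have lin: "linear (\<lambda>v. D v x)" for x
    using has_derivative_linear[OF smooth_on_frechet_derivative(1)[OF f]] by (simp add: D_def)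
  have comm: "frechet_derivative (D v) (at x) u = frechet_derivative (D u) (at x) v" for u v x
    unfolding D_def by (rule symmetric_second_derivative[OF f])
  have "((\<lambda>t. f (\<gamma> t)) has_vector_derivative D (\<gamma>' t) (\<gamma> t)) (at t)" for t
    unfolding D_def by (rule has_vector_derivative_along_curve[OF smooth_on_frechet_derivative(1)[OF f] \<gamma>])
  moreover have "((\<lambda>t. D (\<gamma>' t) (\<gamma> t)) has_vector_derivative \<delta> t) (at t)" for t
  proof -
    \<comment> \<open>Point and direction of \<open>D (\<gamma>' t) (\<gamma> t)\<close> both move;
      in the basis expansion this is a sum of products, each covered by the product rule.\<close>
    have "((\<lambda>t. \<Sum>b\<in>Basis. (\<gamma>' t \<bullet> b) *\<^sub>R D b (\<gamma> t)) has_vector_derivative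
        (\<Sum>b\<in>Basis. (\<gamma>' t \<bullet> b) *\<^sub>R ?DD b (\<gamma> t) (\<gamma>' t) + (\<gamma>'' t \<bullet> b) *\<^sub>R D b (\<gamma> t))) (at t)"
      by (intro has_vector_derivative_sum has_vector_derivative_scaleR
          has_vector_derivative_along_curve[OF D \<gamma>])
        (simp add: has_real_derivative_iff_has_vector_derivative
          bounded_linear.has_vector_derivative[OF bounded_linear_inner_left \<gamma>'])
    moreover have "(\<Sum>b\<in>Basis. (\<gamma>' t \<bullet> b) *\<^sub>R D b (\<gamma> t)) = D (\<gamma>' t) (\<gamma> t)"
      "(\<Sum>b\<in>Basis. (\<gamma>'' t \<bullet> b) *\<^sub>R D b (\<gamma> t)) = D (\<gamma>'' t) (\<gamma> t)" for t
      using linear_euclidean_expansion[OF lin, of "\<gamma>' t" "\<gamma> t"] linear_euclidean_expansion[OF lin, of "\<gamma>'' t" "\<gamma> t"]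
      by simp_all
    moreover have "(\<Sum>b\<in>Basis. (\<gamma>' t \<bullet> b) *\<^sub>R ?DD b (\<gamma> t) (\<gamma>' t)) = ?DD (\<gamma>' t) (\<gamma> t) (\<gamma>' t)"
    proof -
      have "?DD (\<gamma>' t) (\<gamma> t) (\<gamma>' t) = (\<Sum>b\<in>Basis. (\<gamma>' t \<bullet> b) *\<^sub>R ?DD (\<gamma>' t) (\<gamma> t) b)"
        by (rule linear_euclidean_expansion[OF has_derivative_linear[OF D]])
      also have "\<dots> = (\<Sum>b\<in>Basis. (\<gamma>' t \<bullet> b) *\<^sub>R ?DD b (\<gamma> t) (\<gamma>' t))"
        by (intro sum.cong refl arg_cong2[where f = scaleR] comm)
      finally show ?thesis by (rule sym)
    qed
    ultimately show ?thesis by (simp add: \<delta>_def sum.distrib)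
  qed
  moreover have "g (f (\<gamma> t)) (\<delta> t) w + christoffel (f (\<gamma> t)) (D (\<gamma>' t) (\<gamma> t)) w = 0" for t w
  proof -
    obtain w' where "w = frechet_derivative f (at (\<gamma> t)) w'"
      using local_isometry_derivative_surj[OF iso] by (rule surjE)
    then have w: "w = D w' (\<gamma> t)" by (simp only: D_def)
    have "g (f (\<gamma> t)) (D (\<gamma>'' t) (\<gamma> t)) (D w' (\<gamma> t)) = g (\<gamma> t) (\<gamma>'' t) w'"
      using iso by (simp add: local_isometry_def D_def)
    moreover have "g (\<gamma> t) (\<gamma>'' t) w' + christoffel (\<gamma> t) (\<gamma>' t) w' = 0"
      using geo by (simp add: geodesic_def)
    ultimately show ?thesis
      unfolding w \<delta>_def metric_add
      using local_isometry_second_derivative[OF iso, of "\<gamma> t" "\<gamma>' t" w'] by (simp add: D_def)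
  qed
  ultimately have "geodesic (f \<circ> \<gamma>) (\<lambda>t. D (\<gamma>' t) (\<gamma> t)) \<delta>"
    by (simp add: geodesic_def o_def)
  then show ?thesis unfolding D_def by blast
qed

end

section \<open>The metric of N and its geodesics\<close>

definition N_metric_deriv :: "real \<Rightarrow> complex \<times> complex \<Rightarrow> complex \<times> complex \<Rightarrow> complex \<times> complex \<Rightarrow> complex \<times> complex \<Rightarrow> real" where
  "N_metric_deriv \<kappa> x u v w = - \<kappa> * (snd x \<bullet> snd u) * (snd v \<bullet> snd w)"

lemma N_metric_inner:
  "N_metric \<kappa> x v w = fst v \<bullet> snd w + snd v \<bullet> fst w - \<kappa> / 2 * (snd x \<bullet> snd x) * (snd v \<bullet> snd w)"
  by (cases x; cases v; cases w) (simp add: N_metric_def inner_complex_def cmod_power2, simp add: power2_eq_square)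

interpretation N: metric_field "N_metric \<kappa>" "N_metric_deriv \<kappa>" for \<kappa>
proof (rule metric_field.intro)
  show "N_metric \<kappa> x v w = N_metric \<kappa> x w v" for x v w
    by (simp add: N_metric_inner inner_commute)
  show "linear (\<lambda>v. N_metric \<kappa> x v w)" for x w
    by (rule linearI) (simp_all add: N_metric_inner algebra_simps)
  show "((\<lambda>(x, v, w). N_metric \<kappa> x v w) has_derivative
      (\<lambda>(u, v', w'). N_metric_deriv \<kappa> x u v w + N_metric \<kappa> x v' w + N_metric \<kappa> x v w')) (at (x, v, w))" for x v w
    unfolding N_metric_inner N_metric_deriv_def case_prod_unfold
    by (auto intro!: derivative_eq_intros simp: fun_eq_iff inner_commute algebra_simps)
  show "v = 0" if "\<And>w. N_metric \<kappa> x v w = 0" for x v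
  proof -
    \<comment> \<open>The metric pairs the two components with each other, and its correction term
      sees second components only. The first test vector kills \<open>snd v\<close>, and then
      nothing but the pairing is left for \<open>fst v\<close>.\<close>
    have "snd v = 0" using that[of "(snd v, 0)"] by (simp add: N_metric_inner)
    moreover have "fst v = 0" using that[of "(0, fst v)"] \<open>snd v = 0\<close> by (simp add: N_metric_inner)
    ultimately show ?thesis by (simp add: prod_eq_iff)
  qed
qed

lemma N_geodesic_iff:
  "N.geodesic \<kappa> \<gamma> \<gamma>' \<gamma>'' \<longleftrightarrow>
     (\<forall>t. (\<gamma> has_vector_derivative \<gamma>' t) (at t) \<and> (\<gamma>' has_vector_derivative \<gamma>'' t) (at t) \<and>
       \<gamma>'' t = ((\<kappa> * (snd (\<gamma> t) \<bullet> snd (\<gamma>' t))) *\<^sub>R snd (\<gamma>' t)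
         - (\<kappa> / 2 * (snd (\<gamma>' t) \<bullet> snd (\<gamma>' t))) *\<^sub>R snd (\<gamma> t), 0))"
proof -
  have "(\<forall>w. N_metric \<kappa> x a w + N.christoffel \<kappa> x v w = 0) \<longleftrightarrow>
    a = ((\<kappa> * (snd x \<bullet> snd v)) *\<^sub>R snd v - (\<kappa> / 2 * (snd v \<bullet> snd v)) *\<^sub>R snd x, 0)" (is "_ \<longleftrightarrow> a = ?a") for x a v
  proof -
    \<comment> \<open>\<open>?a\<close> solves the lowered equation; subtracting its equation turns
      the general one into orthogonality of \<open>a - ?a\<close> to all vectors.\<close>
    have "N_metric \<kappa> x ?a w + N.christoffel \<kappa> x v w = 0" for w
      by (simp add: N_metric_inner N.christoffel_def N_metric_deriv_def algebra_simps)
    then have "N_metric \<kappa> x a w + N.christoffel \<kappa> x v w = N_metric \<kappa> x (a - ?a) w" for w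
      unfolding N.metric_diff by (simp add: eq_neg_iff_add_eq_0[symmetric])
    then have "(\<forall>w. N_metric \<kappa> x a w + N.christoffel \<kappa> x v w = 0) \<longleftrightarrow> (\<forall>w. N_metric \<kappa> x (a - ?a) w = 0)"
      by simp
    also have "\<dots> \<longleftrightarrow> a = ?a"
      using N.nondegenerate[of \<kappa> x "a - ?a"] by (auto simp: N.metric_zero)
    finally show ?thesis .
  qed
  then show ?thesis by (simp add: N.geodesic_def)
qed

lemma has_vector_derivative_zero_imp_eq:
  fixes f :: "real \<Rightarrow> 'a::real_normed_vector"
  assumes "\<And>t. (f has_vector_derivative 0) (at t)"
  shows "f t = f s"
  using has_vector_derivative_zero_constant[of UNIV f] assms by (metis UNIV_I convex_UNIV has_vector_derivative_at_within)

lemma has_vector_derivative_eq_imp_eq: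
  fixes f :: "real \<Rightarrow> 'a::real_normed_vector"
  assumes "\<And>t. (f has_vector_derivative f' t) (at t)" "\<And>t. (h has_vector_derivative f' t) (at t)" "f s = h s"
  shows "f t = h t"
  using has_vector_derivative_zero_imp_eq[of "\<lambda>t. f t - h t" t s] assms
    has_vector_derivative_diff[of f "f' _" _ h "f' _"] by fastforce

lemma N_geodesic_unique:
  assumes "N.geodesic \<kappa> \<gamma> \<gamma>' \<gamma>''" "N.geodesic \<kappa> \<delta> \<delta>' \<delta>''" "\<gamma> 0 = \<delta> 0" "\<gamma>' 0 = \<delta>' 0"
  shows "\<gamma> = \<delta>"
proof -
  have snd': "(\<lambda>t. snd (\<alpha>' t)) = (\<lambda>_. snd (\<alpha>' 0))" if "N.geodesic \<kappa> \<alpha> \<alpha>' \<alpha>''" for \<alpha> \<alpha>' \<alpha>''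
  proof
    have "((\<lambda>t. snd (\<alpha>' t)) has_vector_derivative snd (\<alpha>'' t)) (at t)" for t
      by (rule bounded_linear.has_vector_derivative[OF bounded_linear_snd]) (use that in \<open>blast dest: N_geodesic_iff[THEN iffD1]\<close>)
    moreover have "snd (\<alpha>'' t) = 0" for t using that by (simp add: N_geodesic_iff)
    ultimately show "snd (\<alpha>' t) = snd (\<alpha>' 0)" for t
      using has_vector_derivative_zero_imp_eq[of "\<lambda>t. snd (\<alpha>' t)"] by metis
  qed
  have \<gamma>: "(\<gamma> has_vector_derivative \<gamma>' t) (at t)" "(\<gamma>' has_vector_derivative \<gamma>'' t) (at t)"
    and \<delta>: "(\<delta> has_vector_derivative \<delta>' t) (at t)" "(\<delta>' has_vector_derivative \<delta>'' t) (at t)" for t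
    using assms unfolding N_geodesic_iff by blast+
  have eq': "snd (\<gamma>' t) = snd (\<delta>' t)" for t
    using snd'[OF assms(1)] snd'[OF assms(2)] assms(4) by metis
  have "snd (\<gamma> t) = snd (\<delta> t)" for t
    by (rule has_vector_derivative_eq_imp_eq[of "\<lambda>t. snd (\<gamma> t)" "\<lambda>t. snd (\<gamma>' t)" "\<lambda>t. snd (\<delta> t)" 0])
      (use bounded_linear.has_vector_derivative[OF bounded_linear_snd \<gamma>(1)]
        bounded_linear.has_vector_derivative[OF bounded_linear_snd \<delta>(1)] eq' assms(3) in simp_all)
  then have "\<gamma>'' t = \<delta>'' t" for t
    using assms(1,2) eq' by (simp add: N_geodesic_iff)
  then have "\<gamma>' t = \<delta>' t" for t
    using has_vector_derivative_eq_imp_eq[of \<gamma>' \<gamma>'' \<delta>' 0] \<gamma>(2) \<delta>(2) assms(4) by presburger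
  then show ?thesis
    using has_vector_derivative_eq_imp_eq[of \<gamma> \<gamma>' \<delta> 0] \<gamma>(1) \<delta>(1) assms(3) by (intro ext) presburger
qed

lemma N_geodesically_connected:
  obtains \<gamma> \<gamma>' \<gamma>'' where "N.geodesic \<kappa> \<gamma> \<gamma>' \<gamma>''" "\<gamma> 0 = p" "\<gamma> 1 = q"
proof -
  define b where "b = snd q - snd p"
  \<comment> \<open>Inserting the affine second component \<open>snd p + t b\<close> into the
    geodesic equation gives the acceleration \<open>c + t d\<close> of the first one;
    \<open>a\<close> is then the initial velocity that reaches \<open>fst q\<close> at time
    1.\<close>
  define c where "c = (\<kappa> * (snd p \<bullet> b)) *\<^sub>R b - (\<kappa> / 2 * (b \<bullet> b)) *\<^sub>R snd p"
  define d where "d = (\<kappa> / 2 * (b \<bullet> b)) *\<^sub>R b"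
  define a where "a = fst q - fst p - (1/2) *\<^sub>R c - (1/6) *\<^sub>R d"
  define \<gamma> where "\<gamma> t = (fst p + t *\<^sub>R a + (t\<^sup>2 / 2) *\<^sub>R c + (t ^ 3 / 6) *\<^sub>R d, snd p + t *\<^sub>R b)" for t :: real
  define \<gamma>' where "\<gamma>' t = (a + t *\<^sub>R c + (t\<^sup>2 / 2) *\<^sub>R d, b)" for t :: real
  define \<gamma>'' where "\<gamma>'' t = (c + t *\<^sub>R d, 0 :: complex)" for t :: real
  have "(\<gamma> has_vector_derivative \<gamma>' t) (at t)" "(\<gamma>' has_vector_derivative \<gamma>'' t) (at t)" for t
    unfolding \<gamma>_def[abs_def] \<gamma>'_def[abs_def] \<gamma>''_def
    by (auto intro!: derivative_eq_intros has_vector_derivative_Pair simp: power2_eq_square)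
  moreover have "\<gamma>'' t = ((\<kappa> * (snd (\<gamma> t) \<bullet> snd (\<gamma>' t))) *\<^sub>R snd (\<gamma>' t)
         - (\<kappa> / 2 * (snd (\<gamma>' t) \<bullet> snd (\<gamma>' t))) *\<^sub>R snd (\<gamma> t), 0)" for t
    by (simp add: \<gamma>''_def \<gamma>'_def \<gamma>_def c_def d_def algebra_simps)
        (simp add: scaleR_conv_of_real)
  ultimately have "N.geodesic \<kappa> \<gamma> \<gamma>' \<gamma>''" by (simp add: N_geodesic_iff)
  moreover have "\<gamma> 0 = p" "\<gamma> 1 = q"
    by (simp_all add: \<gamma>_def a_def b_def prod_eq_iff)
  ultimately show ?thesis by (rule that)
qed

lemma N_isometry_rigid:
  assumes f: "N.local_isometry \<kappa> f" and h: "N.local_isometry \<kappa> h" and "f p = h p"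
    and "frechet_derivative f (at p) = frechet_derivative h (at p)"
  shows "f = h"
proof
  fix q
  obtain \<gamma> \<gamma>' \<gamma>'' where \<gamma>: "N.geodesic \<kappa> \<gamma> \<gamma>' \<gamma>''" "\<gamma> 0 = p" "\<gamma> 1 = q"
    by (rule N_geodesically_connected)
  obtain \<delta> \<delta>' where "N.geodesic \<kappa> (f \<circ> \<gamma>) (\<lambda>t. frechet_derivative f (at (\<gamma> t)) (\<gamma>' t)) \<delta>"
    "N.geodesic \<kappa> (h \<circ> \<gamma>) (\<lambda>t. frechet_derivative h (at (\<gamma> t)) (\<gamma>' t)) \<delta>'"
    using N.local_isometry_geodesic f h \<gamma>(1) by blast
  then have "f \<circ> \<gamma> = h \<circ> \<gamma>"
    by (rule N_geodesic_unique) (simp_all add: \<gamma> assms)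
  then show "f q = h q" by (metis \<gamma>(3) comp_apply)
qed

section \<open>Extrinsic reflections\<close>

lemma ambient_product_inner:
  "ambient_product \<kappa> v w
    = fst v \<bullet> snd (snd w) + snd (snd v) \<bullet> fst w + \<kappa> * fst (snd v) * fst (snd w)"
  by (cases v; cases w) (simp add: ambient_product_def inner_complex_def)

lemma bilinear_ambient_product: "bilinear (ambient_product \<kappa>)"
  by (auto simp: bilinear_def ambient_product_inner algebra_simps intro!: linearI)

lemma scalar_product_ambient_product:
  assumes "\<kappa> \<noteq> 0" shows "scalar_product (ambient_product \<kappa>)"
  unfolding scalar_product_def
proof (intro conjI allI impI)
  show "ambient_product \<kappa> v w = ambient_product \<kappa> w v" for v w
    by (simp add: ambient_product_inner inner_commute)
  show "v = 0" if "\<forall>w. ambient_product \<kappa> v w = 0" for v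
  proof -
    have "snd (snd v) = 0" using that[rule_format, of "(snd (snd v), 0, 0)"] by (simp add: ambient_product_inner)
    moreover have "fst v = 0" using that[rule_format, of "(0, 0, fst v)"] by (simp add: ambient_product_inner)
    moreover have "fst (snd v) = 0"
      using that[rule_format, of "(0, fst (snd v), 0)"] assms by (simp add: ambient_product_inner)
    ultimately show ?thesis by (simp add: prod_eq_iff)
  qed
qed (rule bilinear_ambient_product)

lemma mem_ext_space_iff: "w \<in> ext_space \<longleftrightarrow> fst (snd w) = - (1/2) * (snd (snd w) \<bullet> snd (snd w))"
  by (cases w) (auto simp: ext_space_def power2_norm_eq_inner)

lemma Ck_on_subset: "Ck_on k f UNIV \<Longrightarrow> Ck_on k f S"
  by (induction k arbitrary: f) (auto intro: continuous_on_subset)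

lemma smooth_on_imp_smooth_map_on: "smooth_on f UNIV \<Longrightarrow> smooth_map_on f M"
  unfolding smooth_map_on_def by blast

section \<open>Tangent and normal spaces of M\<close>

lemma tangent_space_ext_space:
  assumes "p \<in> ext_space"
  shows "tangent_space ext_space p = {v. fst (snd v) = - (snd (snd p) \<bullet> snd (snd v))}"
proof (intro equalityI subsetI)
  fix v assume "v \<in> tangent_space ext_space p"
  then obtain \<gamma> e where \<gamma>: "e > 0" "\<forall>t\<in>{-e<..<e}. \<gamma> t \<in> ext_space" "\<gamma> 0 = p"
    "(\<gamma> has_vector_derivative v) (at 0)"
    unfolding tangent_space_def by blast
  have snd: "((\<lambda>t. snd (\<gamma> t)) has_vector_derivative snd v) (at 0)"
    by (rule bounded_linear.has_vector_derivative[OF bounded_linear_snd \<gamma>(4)])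
  have u: "((\<lambda>t. snd (snd (\<gamma> t))) has_derivative (\<lambda>h. h *\<^sub>R snd (snd v))) (at 0)"
    and x: "((\<lambda>t. fst (snd (\<gamma> t))) has_derivative (\<lambda>h. h * fst (snd v))) (at 0)"
    using bounded_linear.has_vector_derivative[OF bounded_linear_snd snd]
      bounded_linear.has_vector_derivative[OF bounded_linear_fst snd]
    by (simp_all add: has_vector_derivative_def)
  \<comment> \<open>Near 0 the equation of M expresses the real coordinate of the curve in this
    form, so its velocity can be computed in two ways.\<close>
  have "((\<lambda>t. - (1/2) * (snd (snd (\<gamma> t)) \<bullet> snd (snd (\<gamma> t)))) has_derivative
      (\<lambda>h. - h * (snd (snd p) \<bullet> snd (snd v)))) (at 0)"
    by (rule has_derivative_eq_rhs[OF has_derivative_mult_right[OF has_derivative_inner[OF u u]]])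
      (simp add: \<gamma>(3) inner_commute)
  then have "((\<lambda>t. fst (snd (\<gamma> t))) has_derivative (\<lambda>h. - h * (snd (snd p) \<bullet> snd (snd v)))) (at 0)"
    by (rule has_derivative_transform_within_open[of _ _ _ _ "{-e<..<e}"])
      (use \<gamma> in \<open>auto simp: mem_ext_space_iff\<close>)
  from has_derivative_unique[OF x this, THEN fun_cong, of 1]
  show "v \<in> {v. fst (snd v) = - (snd (snd p) \<bullet> snd (snd v))}" by simp
next
  fix v :: ambient assume v: "v \<in> {v. fst (snd v) = - (snd (snd p) \<bullet> snd (snd v))}"
  \<comment> \<open>Straight motion in the two complex coordinates; the real one is dictated by the
    equation of M, and the condition on \<open>v\<close> says that its velocity at 0 is
    right.\<close>
  define \<gamma> where "\<gamma> t = (fst p + t *\<^sub>R fst v,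
      (- (1/2)) *\<^sub>R ((snd (snd p) + t *\<^sub>R snd (snd v)) \<bullet> (snd (snd p) + t *\<^sub>R snd (snd v))),
      snd (snd p) + t *\<^sub>R snd (snd v))" for t :: real
  have "smooth_on \<gamma> {-1<..<1}"
    unfolding \<gamma>_def[abs_def] smooth_on_def
    by (intro allI Ck_on_subset[where S = "{-1<..<1}"] Ck_on_intros Ck_on_bounded_linear[OF bounded_linear_ident])
  moreover have "(\<gamma> has_vector_derivative v) (at 0)"
    unfolding \<gamma>_def[abs_def] has_vector_derivative_def
    using v by (auto intro!: derivative_eq_intros simp: fun_eq_iff prod_eq_iff inner_commute)
  moreover have "\<gamma> 0 = p" "\<gamma> t \<in> ext_space" for t
    using assms by (auto simp: \<gamma>_def prod_eq_iff mem_ext_space_iff)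
  ultimately show "v \<in> tangent_space ext_space p"
    unfolding tangent_space_def by (intro CollectI exI[of _ \<gamma>] exI[of _ 1]) auto
qed

lemma affine_normal_space_ext_space:
  assumes "p \<in> ext_space"
  shows "affine_normal_space (ambient_product \<kappa>) ext_space p
    = range (\<lambda>t. p + t *\<^sub>R (\<kappa> *\<^sub>R snd (snd p), 1, 0))"
proof -
  have "(\<forall>v\<in>tangent_space ext_space p. ambient_product \<kappa> n v = 0)
      \<longleftrightarrow> n = fst (snd n) *\<^sub>R (\<kappa> *\<^sub>R snd (snd p), 1, 0)" (is "?L \<longleftrightarrow> ?R") for n
  proof
    assume L: ?L
    have *: "ambient_product \<kappa> n (a, - (snd (snd p) \<bullet> b), b) = 0" for a b
      using L assms by (simp add: tangent_space_ext_space)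
    have "snd (snd n) = 0" using *[of "snd (snd n)" 0] by (simp add: ambient_product_inner)
    moreover have "fst n = (fst (snd n) * \<kappa>) *\<^sub>R snd (snd p)"
    proof -
      \<comment> \<open>\<open>d\<close> is the error in the first component. Pairing
        \<open>n\<close> with the tangent vector over \<open>d\<close> itself returns the squared
        length of \<open>d\<close>.\<close>
      define d where "d = fst n - (fst (snd n) * \<kappa>) *\<^sub>R snd (snd p)"
      have "d \<bullet> d = ambient_product \<kappa> n (0, - (snd (snd p) \<bullet> d), d)"
        by (subst (1) d_def) (simp add: inner_diff_left ambient_product_inner)
      then show ?thesis using *[of 0 d] by (simp add: d_def)
    qed
    ultimately show ?R by (simp add: prod_eq_iff)
  next
    assume R: ?R
    show ?L
      by (subst R) (auto simp: tangent_space_ext_space[OF assms] ambient_product_inner)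
  qed
  then show ?thesis
    unfolding affine_normal_space_def
    by (auto simp: image_iff)
qed

text \<open>Tangent vectors with vanishing last component detect the last component of
  \<open>v\<close>; tangency then kills its real one, and the remaining first component is detected
  by tangent vectors over \<open>b\<close>.\<close>

lemma ext_space_tangent_nondegenerate:
  assumes p: "p \<in> ext_space" and v: "v \<in> tangent_space ext_space p"
    and 0: "\<forall>w\<in>tangent_space ext_space p. ambient_product \<kappa> v w = 0"
  shows "v = 0"
proof -
  have *: "ambient_product \<kappa> v (a, - (snd (snd p) \<bullet> b), b) = 0" for a b
    using 0 p by (simp add: tangent_space_ext_space)
  have "snd (snd v) = 0" using *[of "snd (snd v)" 0] by (simp add: ambient_product_inner)
  moreover from this have "fst (snd v) = 0" using v p by (simp add: tangent_space_ext_space)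
  moreover from calculation have "fst v = 0" using *[of 0 "fst v"] by (simp add: ambient_product_inner)
  ultimately show ?thesis by (simp add: prod_eq_iff)
qed

text \<open>With the normal vector n = (\<kappa> p2, 1, 0) and c the coefficient of n when
  \<open>w - p\<close> is split into tangent and normal part, this is 2p - w + 2cn. The real
  coordinate of p enters through its value - |p2|^2 / 2 on M, so the formula is an involution for
  every p.\<close>

definition ext_reflection :: "real \<Rightarrow> ambient \<Rightarrow> ambient \<Rightarrow> ambient" where
  "ext_reflection \<kappa> = (\<lambda>(p1, _, p2) (w1, x, w2).
     (2 *\<^sub>R p1 - w1 + (2 * \<kappa> * (x - (p2 \<bullet> p2) / 2 + p2 \<bullet> w2)) *\<^sub>R p2, x + 2 * (p2 \<bullet> w2) - 2 * (p2 \<bullet> p2), 2 *\<^sub>R p2 - w2))"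

lemma extrinsic_reflection_ext_space:
  assumes p: "p \<in> ext_space"
  shows "extrinsic_reflection (ambient_product \<kappa>) ext_space p = ext_reflection \<kappa> p"
  unfolding extrinsic_reflection_def
proof (rule the_equality)
  define p1 p2 where "p1 = fst p" and "p2 = snd (snd p)"
  have p_eq: "p = (p1, - (1/2) * (p2 \<bullet> p2), p2)"
    using p by (auto simp: p1_def p2_def mem_ext_space_iff prod_eq_iff)
  define A where "A = (\<lambda>(v1 :: complex, x :: real, v2 :: complex).
    (- v1 + (2 * \<kappa> * (x + p2 \<bullet> v2)) *\<^sub>R p2, x + 2 * (p2 \<bullet> v2), - v2))"
  have A: "ext_reflection \<kappa> p w = A w + (p - A p)" for w
    by (cases w) (simp add: A_def ext_reflection_def p_eq complex_eq_iff algebra_simps)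
  have lin: "linear A"
    by (rule linearI) (auto simp: A_def algebra_simps)
  have tan: "A v = - v" if "v \<in> tangent_space ext_space p" for v
  proof -
    have "fst (snd v) = - (p2 \<bullet> snd (snd v))"
      using that by (simp add: tangent_space_ext_space[OF p] p2_def)
    then show ?thesis by (cases v) (simp add: A_def)
  qed
  have nor: "ext_reflection \<kappa> p w = w" if w: "w \<in> affine_normal_space (ambient_product \<kappa>) ext_space p" for w
  proof -
    obtain t where "w = p + t *\<^sub>R (\<kappa> *\<^sub>R p2, 1, 0)"
      using w unfolding affine_normal_space_ext_space[OF p] p2_def by blast
    then show ?thesis by (simp add: ext_reflection_def p_eq complex_eq_iff algebra_simps)
  qed
  show "\<exists>A b. linear A \<and> ext_reflection \<kappa> p = (\<lambda>w. A w + b) \<and>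
      (\<forall>v\<in>tangent_space ext_space p. A v = - v) \<and>
      (\<forall>w\<in>affine_normal_space (ambient_product \<kappa>) ext_space p. ext_reflection \<kappa> p w = w)"
    using lin tan nor A by (intro exI[of _ A] exI[of _ "p - A p"]) auto
  fix s assume "\<exists>A b. linear A \<and> s = (\<lambda>w. A w + b) \<and>
      (\<forall>v\<in>tangent_space ext_space p. A v = - v) \<and>
      (\<forall>w\<in>affine_normal_space (ambient_product \<kappa>) ext_space p. s w = w)"
  then obtain A' b where A': "linear A'" "s = (\<lambda>w. A' w + b)"
    "\<And>v. v \<in> tangent_space ext_space p \<Longrightarrow> A' v = - v"
    "\<And>w. w \<in> affine_normal_space (ambient_product \<kappa>) ext_space p \<Longrightarrow> s w = w"
    by blast
  define n :: ambient where "n = (\<kappa> *\<^sub>R p2, 1, 0)"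
  \<comment> \<open>The parameters 0 and 1 suffice: fixing \<open>p\<close> determines the
    translation part, and fixing \<open>p + n\<close> as well gives a linear part that fixes
    \<open>n\<close>.\<close>
  have "p + t *\<^sub>R n \<in> affine_normal_space (ambient_product \<kappa>) ext_space p" for t
    by (auto simp: affine_normal_space_ext_space[OF p] p2_def n_def)
  with A'(4) nor have sn: "s (p + t *\<^sub>R n) = p + t *\<^sub>R n" "ext_reflection \<kappa> p (p + t *\<^sub>R n) = p + t *\<^sub>R n" for t
    by blast+
  have b: "b = p - A' p" using sn(1)[of 0] A'(2) by (simp add: algebra_simps)
  have "A n = n"
    using sn(2)[of 1] by (simp add: A linear_add[OF lin])
  moreover have "A' n = n"
  proof -
    have "A' n = (A' (p + n) + b) - (A' p + b)" by (simp add: linear_add[OF A'(1)])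
    also have "\<dots> = n" using sn(1)[of 0] sn(1)[of 1] A'(2) by simp
    finally show ?thesis .
  qed
  \<comment> \<open>The coefficient of \<open>n\<close> is the amount by which \<open>w\<close>
    violates the tangency equation; for \<open>n\<close> itself this amount is 1.\<close>
  moreover have "\<exists>v c. v \<in> tangent_space ext_space p \<and> w = v + c *\<^sub>R n" for w
    by (intro exI[of _ "w - (fst (snd w) + p2 \<bullet> snd (snd w)) *\<^sub>R n"] exI[of _ "fst (snd w) + p2 \<bullet> snd (snd w)"])
      (simp add: tangent_space_ext_space[OF p] n_def p2_def algebra_simps)
  ultimately have AA: "A' w = A w" for w
    using A'(3) tan by (metis linear_add[OF A'(1)] linear_add[OF lin] linear_scale[OF A'(1)] linear_scale[OF lin])
  show "s = ext_reflection \<kappa> p"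
    by (rule ext) (simp add: A A'(2) b AA)
qed

lemma ext_reflection_in_ext_space:
  assumes "p \<in> ext_space" "w \<in> ext_space" shows "ext_reflection \<kappa> p w \<in> ext_space"
  using assms by (cases p; cases w) (simp add: mem_ext_space_iff ext_reflection_def algebra_simps inner_commute)

lemma ext_reflection_involution: "ext_reflection \<kappa> p (ext_reflection \<kappa> p w) = w"
  by (cases p; cases w) (simp add: ext_reflection_def complex_eq_iff algebra_simps)

lemma involution_image:
  assumes "\<And>x. f (f x) = x" "\<And>x. x \<in> S \<Longrightarrow> f x \<in> S" shows "f ` S = S"
proof (intro equalityI subsetI)
  fix x assume "x \<in> S"
  then show "x \<in> f ` S" by (intro image_eqI[of x f "f x"]) (simp_all add: assms)
qed (auto simp: assms)

lemma ext_reflection_image: "p \<in> ext_space \<Longrightarrow> ext_reflection \<kappa> p ` ext_space = ext_space"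
  by (rule involution_image[OF ext_reflection_involution ext_reflection_in_ext_space])

section \<open>M as a submanifold\<close>

lemma smooth_on_polynomial_shear:
  "smooth_on (\<lambda>w :: ambient. (fst w, fst (snd w) + c *\<^sub>R (snd (snd w) \<bullet> snd (snd w)), snd (snd w))) UNIV"
  unfolding smooth_on_def by (intro allI Ck_on_intros Ck_on_projections)

text \<open>M is the graph of a quadratic function, so one global chart is enough: a shear, inverted
  by the shear of opposite sign, flattens M onto the hyperplane of vanishing real
  coordinate.\<close>

lemma submanifold_ext_space: "submanifold ext_space"
proof -
  define \<phi> :: "real \<Rightarrow> ambient \<Rightarrow> ambient"
    where "\<phi> c w = (fst w, fst (snd w) + c *\<^sub>R (snd (snd w) \<bullet> snd (snd w)), snd (snd w))" for c w
  define S :: "ambient set" where "S = {w. fst (snd w) = 0}"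
  have smooth: "smooth_on (\<phi> c) UNIV" for c
    unfolding \<phi>_def[abs_def] by (rule smooth_on_polynomial_shear)
  have inv: "\<phi> c (\<phi> (- c) w) = w" for c w by (simp add: \<phi>_def prod_eq_iff)
  have "homeomorphism UNIV UNIV (\<phi> (1/2)) (\<phi> (- (1/2)))"
    using inv[of "1/2"] inv[of "- (1/2)"] smooth_on_continuous_on[OF smooth]
    by (intro homeomorphismI) auto
  moreover have "subspace S" by (auto simp: S_def subspace_def)
  moreover have "\<phi> (1/2) ` (ext_space \<inter> UNIV) = S \<inter> UNIV"
  proof -
    have "w \<in> ext_space \<longleftrightarrow> \<phi> (1/2) w \<in> S" for w
      by (auto simp: mem_ext_space_iff \<phi>_def S_def)
    then have "ext_space = \<phi> (1/2) -` S" by blast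
    moreover have "surj (\<phi> (1/2))" by (rule surjI[of _ "\<phi> (- (1/2))"]) (rule inv)
    ultimately show ?thesis by (metis Int_UNIV_right surj_image_vimage_eq)
  qed
  ultimately show ?thesis
    unfolding submanifold_def using smooth
    by (intro exI[of _ "dim S"] ballI exI[of _ UNIV] exI[of _ "\<phi> (1/2)"] exI[of _ "\<phi> (- (1/2))"] exI[of _ S]) simp
qed

lemma extrinsic_symmetric_ext_space:
  "\<kappa> \<noteq> 0 \<Longrightarrow> extrinsic_symmetric (ambient_product \<kappa>) ext_space"
  unfolding extrinsic_symmetric_def
  by (intro conjI ballI impI scalar_product_ambient_product submanifold_ext_space)
    (assumption, erule (2) ext_space_tangent_nondegenerate,
      simp add: extrinsic_reflection_ext_space ext_reflection_image)

section \<open>The matrix group\<close>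

lemma to_R2_of_R2 [simp]: "to_R2 (of_R2 v) = v" "of_R2 (to_R2 z) = z"
  by (simp_all add: to_R2_def of_R2_def vec_eq_iff forall_2 complex_eq_iff)

lemma to_R2_nth [simp]: "to_R2 z $ 1 = Re z" "to_R2 z $ 2 = Im z"
  by (simp_all add: to_R2_def)

lemma inner_to_R2 [simp]: "to_R2 z \<bullet> to_R2 w = z \<bullet> w"
  by (simp add: inner_vec_def sum_2 inner_complex_def)

lemma linear_to_R2: "linear to_R2" and linear_of_R2: "linear of_R2"
  by (auto intro!: linearI simp: vec_eq_iff forall_2 of_R2_def complex_eq_iff)

text \<open>The block matrix in complex notation: the matrix product of X with its transpose sends b
  to (X \<bullet> b) X, and the skew block is y times multiplication by \<i>.\<close>

definition Ghat_map :: "real \<Rightarrow> complex \<Rightarrow> real \<Rightarrow> complex \<Rightarrow> ambient \<Rightarrow> ambient" where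
  "Ghat_map \<kappa> X y Z = (\<lambda>(a, x, b).
     (a + (\<kappa> * x - \<kappa> / 2 * (X \<bullet> b)) *\<^sub>R X + y *\<^sub>R (\<i> * b) + Z, x - X \<bullet> b - (X \<bullet> X) / 2, b + X))"

lemma Ghat_matrices_eq: "Ghat_matrices \<kappa> = {Ghat_map \<kappa> X y Z | X y Z. True}"
proof -
  have eq: "block_affine (mat 1) (\<kappa> *\<^sub>R to_R2 X)
      ((- \<kappa> / 2) *\<^sub>R ((columnvector (to_R2 X) :: real^1^2) ** (rowvector (to_R2 X) :: real^2^1))
        + vector [vector [0, - y], vector [y, 0]]) (to_R2 Z)
      0 1 (- to_R2 X) (- (1/2) * (to_R2 X \<bullet> to_R2 X)) 0 0 (mat 1) (to_R2 X) = Ghat_map \<kappa> X y Z" for X y Z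
    by (rule ext) (auto simp: block_affine_def Ghat_map_def of_R2_def complex_eq_iff matrix_vector_mult_def
        matrix_matrix_mult_def columnvector_def rowvector_def sum_2 mat_def inner_vec_def inner_complex_def
        UNIV_1 algebra_simps)
  show ?thesis
  proof (intro equalityI subsetI)
    fix f assume "f \<in> Ghat_matrices \<kappa>"
    then obtain X Z y where "f = block_affine (mat 1) (\<kappa> *\<^sub>R X)
      ((- \<kappa> / 2) *\<^sub>R ((columnvector X :: real^1^2) ** (rowvector X :: real^2^1))
        + vector [vector [0, - y], vector [y, 0]]) Z
      0 1 (- X) (- (1/2) * (X \<bullet> X)) 0 0 (mat 1) X"
      unfolding Ghat_matrices_def by blast
    with eq[of "of_R2 X" y "of_R2 Z"] show "f \<in> {Ghat_map \<kappa> X y Z | X y Z. True}"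
      by auto
  next
    fix f assume "f \<in> {Ghat_map \<kappa> X y Z | X y Z. True}"
    then obtain X y Z where "f = Ghat_map \<kappa> X y Z" by blast
    then show "f \<in> Ghat_matrices \<kappa>"
      unfolding Ghat_matrices_def eq[symmetric] by blast
  qed
qed

lemma Ghat_map_in [simp]: "Ghat_map \<kappa> X y Z \<in> Ghat_matrices \<kappa>"
  by (auto simp: Ghat_matrices_eq)

lemma Ghat_map_0: "Ghat_map \<kappa> 0 0 0 = id"
  by (auto simp: Ghat_map_def)

text \<open>A Heisenberg-like law: the X parts add up, while y picks up \<kappa>/2 times the signed
  area \<open>Im (cnj X * X')\<close>. This is the only source of y in products of maps with y =
  0.\<close>

lemma Ghat_map_comp:
  "Ghat_map \<kappa> X y Z \<circ> Ghat_map \<kappa> X' y' Z' =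
    Ghat_map \<kappa> (X + X') (y + y' + \<kappa> / 2 * Im (cnj X * X'))
      (Z + Z' - (\<kappa> / 2 * (X' \<bullet> X') + \<kappa> / 2 * (X \<bullet> X')) *\<^sub>R X + y *\<^sub>R (\<i> * X'))"
  by (rule ext) (auto simp: Ghat_map_def complex_eq_iff inner_complex_def field_simps)

lemma Ghat_map_inverse:
  "Ghat_map \<kappa> X y Z \<circ> Ghat_map \<kappa> (- X) (- y) (y *\<^sub>R (\<i> * X) - Z) = id"
  "Ghat_map \<kappa> (- X) (- y) (y *\<^sub>R (\<i> * X) - Z) \<circ> Ghat_map \<kappa> X y Z = id"
  by (simp_all add: Ghat_map_comp Ghat_map_0 mult.commute)

lemma Ghat_map_in_ext_space: "w \<in> ext_space \<Longrightarrow> Ghat_map \<kappa> X y Z w \<in> ext_space"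
  by (cases w) (simp add: mem_ext_space_iff Ghat_map_def algebra_simps inner_commute)

lemma zero_in_ext_space: "0 \<in> ext_space"
  by (simp add: mem_ext_space_iff)

text \<open>The image of the origin displays \<open>X\<close> and \<open>Z\<close>, and the image of
  one point of M with last coordinate 1 then displays \<open>y\<close>. Transport to N remembers
  only the restriction to M, so injectivity of that transport depends on this.\<close>

lemma Ghat_map_eq_on_ext_space:
  assumes "\<And>w. w \<in> ext_space \<Longrightarrow> Ghat_map \<kappa> X y Z w = Ghat_map \<kappa> X' y' Z' w"
  shows "Ghat_map \<kappa> X y Z = Ghat_map \<kappa> X' y' Z'"
proof -
  have "Ghat_map \<kappa> X y Z 0 = Ghat_map \<kappa> X' y' Z' 0"
    by (rule assms[OF zero_in_ext_space])
  then have [simp]: "X = X'" "Z = Z'" by (auto simp: Ghat_map_def zero_prod_def)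
  have "Ghat_map \<kappa> X y Z (0, - (1/2), 1) = Ghat_map \<kappa> X' y' Z' (0, - (1/2), 1)"
    by (rule assms) (simp add: mem_ext_space_iff)
  then show ?thesis by (auto simp: Ghat_map_def)
qed

section \<open>Groups of bijections\<close>

lemma carrier_BijGroup_UNIV: "carrier (BijGroup UNIV) = {f. bij f}"
  by (simp add: BijGroup_def Bij_def)

lemma one_BijGroup_UNIV: "\<one>\<^bsub>BijGroup UNIV\<^esub> = id"
  by (simp add: BijGroup_def id_def restrict_def)

lemma mult_BijGroup_UNIV: "bij f \<Longrightarrow> bij g \<Longrightarrow> f \<otimes>\<^bsub>BijGroup UNIV\<^esub> g = f \<circ> g"
  by (simp add: BijGroup_def Bij_def compose_def o_def restrict_def)

lemma inv_BijGroup_UNIV: "bij f \<Longrightarrow> inv\<^bsub>BijGroup UNIV\<^esub> f = inv_into UNIV f"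
  by (rule group.inv_equality[OF group_BijGroup])
    (simp_all add: mult_BijGroup_UNIV one_BijGroup_UNIV carrier_BijGroup_UNIV bij_imp_bij_inv bij_is_inj)

lemma subgroup_BijGroup_UNIV_I:
  assumes "id \<in> H" "\<And>f g. f \<in> H \<Longrightarrow> g \<in> H \<Longrightarrow> f \<circ> g \<in> H"
    and "\<And>f. f \<in> H \<Longrightarrow> \<exists>g\<in>H. f \<circ> g = id \<and> g \<circ> f = id"
  shows "subgroup H (BijGroup UNIV)"
proof -
  have bij: "bij f" if "f \<in> H" for f
    using assms(3)[OF that] o_bij by blast
  show ?thesis
  proof (rule group.subgroupI[OF group_BijGroup])
    show "H \<subseteq> carrier (BijGroup UNIV)" using bij by (auto simp: carrier_BijGroup_UNIV)
    show "inv\<^bsub>BijGroup UNIV\<^esub> f \<in> H" if f: "f \<in> H" for f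
      using assms(3)[OF f] by (metis inv_BijGroup_UNIV[OF bij[OF f]] inv_unique_comp)
    show "f \<otimes>\<^bsub>BijGroup UNIV\<^esub> g \<in> H" if "f \<in> H" "g \<in> H" for f g
      using that by (simp add: mult_BijGroup_UNIV bij assms(2))
  qed (use assms(1) in blast)
qed

lemma transformation_group_simps:
  "carrier (transformation_group H) = H"
  "\<one>\<^bsub>transformation_group H\<^esub> = id"
  "f \<otimes>\<^bsub>transformation_group H\<^esub> g = f \<otimes>\<^bsub>BijGroup UNIV\<^esub> g"
  by (simp_all add: transformation_group_def one_BijGroup_UNIV)

lemma subgroup_BijGroup_UNIV_bij: "subgroup H (BijGroup UNIV) \<Longrightarrow> f \<in> H \<Longrightarrow> bij f"
  using subgroup.subset carrier_BijGroup_UNIV by blast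

lemma subgroup_BijGroup_UNIV_comp:
  assumes "subgroup H (BijGroup UNIV)" "f \<in> H" "g \<in> H" shows "f \<circ> g \<in> H"
  using subgroup.m_closed[OF assms] subgroup_BijGroup_UNIV_bij[OF assms(1)] assms(2,3)
  by (simp add: mult_BijGroup_UNIV)

lemma subgroup_BijGroup_UNIV_inv:
  assumes "subgroup H (BijGroup UNIV)" "f \<in> H" shows "inv_into UNIV f \<in> H"
  using subgroup.m_inv_closed[OF assms] subgroup_BijGroup_UNIV_bij[OF assms]
  by (simp add: inv_BijGroup_UNIV)

text \<open>The inclusion for the inverse of \<open>f\<close> is the opposite inclusion for
  \<open>f\<close>.\<close>

lemma subgroup_BijGroup_UNIV_image:
  assumes H: "subgroup H (BijGroup UNIV)" and "f \<in> H" and sub: "\<And>g. g \<in> H \<Longrightarrow> g ` M \<subseteq> M"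
  shows "f ` M = M"
proof -
  have bij: "bij f" and "inv_into UNIV f \<in> H"
    using subgroup_BijGroup_UNIV_bij[OF H \<open>f \<in> H\<close>] subgroup.m_inv_closed[OF H \<open>f \<in> H\<close>]
    by (auto simp: inv_BijGroup_UNIV)
  then have "f ` (inv_into UNIV f ` M) \<subseteq> f ` M" using sub by (intro image_mono) blast
  then have "M \<subseteq> f ` M" using bij by (simp add: image_f_inv_f bij_is_surj)
  with sub[OF \<open>f \<in> H\<close>] show ?thesis by (rule subset_antisym)
qed

lemma group_transformation_group:
  "subgroup H (BijGroup UNIV) \<Longrightarrow> group (transformation_group H)"
  unfolding transformation_group_def by (rule group.subgroup_imp_group[OF group_BijGroup])

lemma subgroup_transformation_group:
  assumes "subgroup H (BijGroup UNIV)" "subgroup K (BijGroup UNIV)" "K \<subseteq> H"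
  shows "subgroup K (transformation_group H)"
  unfolding transformation_group_def by (rule group.subgroup_incl[OF group_BijGroup assms(2,1,3)])

lemma inv_transformation_group:
  assumes "subgroup H (BijGroup UNIV)" "f \<in> H"
  shows "inv\<^bsub>transformation_group H\<^esub> f = inv_into UNIV f"
  unfolding transformation_group_def
  using group.m_inv_consistent[OF group_BijGroup assms] inv_BijGroup_UNIV[OF subgroup_BijGroup_UNIV_bij[OF assms]]
  by simp

lemma subgroup_Ghat: "subgroup (Ghat_matrices \<kappa>) (BijGroup UNIV)"
proof (rule subgroup_BijGroup_UNIV_I)
  show "id \<in> Ghat_matrices \<kappa>" by (simp flip: Ghat_map_0[of \<kappa>])
  show "f \<circ> g \<in> Ghat_matrices \<kappa>" if fg: "f \<in> Ghat_matrices \<kappa>" "g \<in> Ghat_matrices \<kappa>" for f g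
  proof -
    obtain X y Z X' y' Z' where "f = Ghat_map \<kappa> X y Z" "g = Ghat_map \<kappa> X' y' Z'"
      using fg by (auto simp: Ghat_matrices_eq)
    then show ?thesis by (simp add: Ghat_map_comp)
  qed
  show "\<exists>g\<in>Ghat_matrices \<kappa>. f \<circ> g = id \<and> g \<circ> f = id" if f: "f \<in> Ghat_matrices \<kappa>" for f
  proof -
    obtain X y Z where "f = Ghat_map \<kappa> X y Z" using f by (auto simp: Ghat_matrices_eq)
    then show ?thesis
      using Ghat_map_inverse[of \<kappa> X y Z] Ghat_map_in by blast
  qed
qed

section \<open>The extrinsic transvection group\<close>

text \<open>All reflections lie in one coset of the matrix group, that of the reflection in 0. The X
  part is doubled because a reflection moves the origin to twice the base point in the last
  coordinate.\<close>

lemma ext_reflection_eq: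
  "ext_reflection \<kappa> p = Ghat_map \<kappa> (2 *\<^sub>R snd (snd p)) 0
     (2 *\<^sub>R fst p - (\<kappa> * (snd (snd p) \<bullet> snd (snd p))) *\<^sub>R snd (snd p)) \<circ> ext_reflection \<kappa> 0"
  by (rule ext, cases p) (auto simp: ext_reflection_def Ghat_map_def zero_prod_def complex_eq_iff algebra_simps)

text \<open>The reflection in 0 normalizes the matrix group; its signs on X, y, Z are those of
  \<open>lie_involution\<close> on the components e, a, s. Two reflections from the coset of the
  reflection in 0 therefore multiply into the matrix group.\<close>

lemma ext_reflection_0_conj_Ghat_map:
  "ext_reflection \<kappa> 0 \<circ> Ghat_map \<kappa> X y Z \<circ> ext_reflection \<kappa> 0 = Ghat_map \<kappa> (- X) y (- Z)"
  by (rule ext) (auto simp: ext_reflection_def Ghat_map_def zero_prod_def complex_eq_iff algebra_simps)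

lemma ext_reflection_comp_in_Ghat: "ext_reflection \<kappa> p \<circ> ext_reflection \<kappa> q \<in> Ghat_matrices \<kappa>"
proof -
  obtain X Z X' Z' where "ext_reflection \<kappa> p = Ghat_map \<kappa> X 0 Z \<circ> ext_reflection \<kappa> 0"
    "ext_reflection \<kappa> q = Ghat_map \<kappa> X' 0 Z' \<circ> ext_reflection \<kappa> 0"
    using ext_reflection_eq by blast
  then have "ext_reflection \<kappa> p \<circ> ext_reflection \<kappa> q = Ghat_map \<kappa> X 0 Z \<circ> Ghat_map \<kappa> (- X') 0 (- Z')"
    by (simp add: o_assoc flip: ext_reflection_0_conj_Ghat_map)
  then show ?thesis by (simp add: Ghat_map_comp)
qed

definition ext_transvection_generators :: "real \<Rightarrow> (ambient \<Rightarrow> ambient) set" where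
  "ext_transvection_generators \<kappa> = {ext_reflection \<kappa> p \<circ> ext_reflection \<kappa> q | p q. p \<in> ext_space \<and> q \<in> ext_space}"

lemma Ghat_map_translation_generator: "Ghat_map \<kappa> X 0 Z \<in> ext_transvection_generators \<kappa>"
proof -
  \<comment> \<open>Obtained by solving \<open>ext_reflection_eq\<close> for the base point: its
    last component is X/2, the equation of M forces the real one, and the first one compensates the
    cubic term \<kappa> |X/2|^2 X/2.\<close>
  define p :: ambient where "p = ((1/2) *\<^sub>R (Z + (\<kappa> * (X \<bullet> X) / 8) *\<^sub>R X), - (X \<bullet> X) / 8, (1/2) *\<^sub>R X)"
  have "ext_reflection \<kappa> p = Ghat_map \<kappa> X 0 Z \<circ> ext_reflection \<kappa> 0"
    by (subst ext_reflection_eq) (simp add: p_def algebra_simps)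
  then have "Ghat_map \<kappa> X 0 Z = ext_reflection \<kappa> p \<circ> ext_reflection \<kappa> 0"
    by (auto simp: ext_reflection_involution)
  moreover have "p \<in> ext_space" by (simp add: p_def mem_ext_space_iff)
  ultimately show ?thesis
    unfolding ext_transvection_generators_def using zero_in_ext_space by blast
qed

lemma generate_ext_transvection_generators:
  assumes "\<kappa> \<noteq> 0"
  shows "generate (BijGroup UNIV) (ext_transvection_generators \<kappa>) = Ghat_matrices \<kappa>"
proof (intro equalityI subsetI)
  have "ext_transvection_generators \<kappa> \<subseteq> Ghat_matrices \<kappa>"
    by (auto simp: ext_transvection_generators_def ext_reflection_comp_in_Ghat)
  then show "f \<in> Ghat_matrices \<kappa>" if "f \<in> generate (BijGroup UNIV) (ext_transvection_generators \<kappa>)" for f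
    using group.generate_subgroup_incl[OF group_BijGroup _ subgroup_Ghat] that by blast
  have bij: "bij (Ghat_map \<kappa> X y Z)" for X y Z
    by (rule subgroup_BijGroup_UNIV_bij[OF subgroup_Ghat Ghat_map_in])
  have comp: "f \<circ> g \<in> generate (BijGroup UNIV) (ext_transvection_generators \<kappa>)"
    if "f \<in> generate (BijGroup UNIV) (ext_transvection_generators \<kappa>)" "bij f"
      "g \<in> generate (BijGroup UNIV) (ext_transvection_generators \<kappa>)" "bij g" for f g
    using generate.eng[OF that(1,3)] that(2,4) by (simp add: mult_BijGroup_UNIV)
  have 0: "Ghat_map \<kappa> X 0 Z \<in> generate (BijGroup UNIV) (ext_transvection_generators \<kappa>)" for X Z
    by (rule generate.incl[OF Ghat_map_translation_generator])
  have 1: "\<exists>Z. Ghat_map \<kappa> 0 y Z \<in> generate (BijGroup UNIV) (ext_transvection_generators \<kappa>)" for y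
  proof -
    \<comment> \<open>The X parts run around the triangle 0, 1, 1 + t. Its signed area times
      \<kappa> is \<kappa>/2 Im t, which is y for this t; the closing factor is parallel to the sum
      of the other two and adds nothing.\<close>
    define t where "t = Complex 0 (2 * y / \<kappa>)"
    have "\<exists>Z. Ghat_map \<kappa> 1 0 0 \<circ> Ghat_map \<kappa> t 0 0 \<circ> Ghat_map \<kappa> (- (1 + t)) 0 0 = Ghat_map \<kappa> 0 y Z"
      using assms by (simp add: Ghat_map_comp t_def) (auto simp: algebra_simps)
    then show ?thesis
      using comp[OF comp[OF 0 bij 0 bij] bij_comp[OF bij bij] 0 bij] by metis
  qed
  fix f assume "f \<in> Ghat_matrices \<kappa>"
  then obtain X y Z where f: "f = Ghat_map \<kappa> X y Z" by (auto simp: Ghat_matrices_eq)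
  obtain Z' where Z': "Ghat_map \<kappa> 0 y Z' \<in> generate (BijGroup UNIV) (ext_transvection_generators \<kappa>)"
    using 1 by blast
  \<comment> \<open>The first factor comes with an uncontrolled \<open>Z'\<close>; the second is a
    generator with free Z part and corrects it.\<close>
  have "f = Ghat_map \<kappa> 0 y Z' \<circ> Ghat_map \<kappa> X 0 (Z - Z' - y *\<^sub>R (\<i> * X))"
    by (simp add: f Ghat_map_comp)
  then show "f \<in> generate (BijGroup UNIV) (ext_transvection_generators \<kappa>)"
    using comp[OF Z' bij 0 bij] by simp
qed

lemma extrinsic_transvections_eq:
  assumes "\<kappa> \<noteq> 0"
  shows "extrinsic_transvections (ambient_product \<kappa>) ext_space = Ghat_matrices \<kappa>"
proof -
  have "{extrinsic_reflection (ambient_product \<kappa>) ext_space x \<circ> extrinsic_reflection (ambient_product \<kappa>) ext_space y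
      | x y. x \<in> ext_space \<and> y \<in> ext_space} = ext_transvection_generators \<kappa>"
    unfolding ext_transvection_generators_def by (auto simp: extrinsic_reflection_ext_space) (metis extrinsic_reflection_ext_space)+
  then show ?thesis
    unfolding extrinsic_transvections_def by (simp add: generate_ext_transvection_generators[OF assms])
qed

section \<open>The orthogonal group\<close>

text \<open>The images c of 1 and d of \<i> are orthonormal, so \<open>cnj c * d\<close> has modulus
  one and real part 0. Hence d is \<i> c or - \<i> c.\<close>

lemma orthogonal_complex_cases:
  assumes "orthogonal_transformation S"
  obtains c where "cmod c = 1" "S = (\<lambda>z. c * z)" | c where "cmod c = 1" "S = (\<lambda>z. c * cnj z)"
proof -
  have lin: "linear S" and inn: "S v \<bullet> S w = v \<bullet> w" and nrm: "norm (S v) = norm v" for v w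
    using assms by (auto simp: orthogonal_transformation_def intro: orthogonal_transformation_norm[OF assms])
  define c d where "c = S 1" and "d = S \<i>"
  have c: "cmod c = 1" and d: "cmod d = 1" using nrm[of 1] nrm[of \<i>] by (simp_all add: c_def d_def)
  define t where "t = Im (cnj c * d)"
  have "Re (cnj c * d) = 0"
    using inn[of 1 \<i>] by (simp add: c_def d_def inner_complex_def)
  then have t: "cnj c * d = t * \<i>" by (simp add: t_def complex_eq_iff)
  have "cnj c * c = 1" using c by (simp add: complex_norm_square[symmetric] mult.commute)
  then have d_eq: "d = t * \<i> * c" using t by (metis mult.assoc mult.commute mult.left_neutral)
  have "\<bar>t\<bar> = 1" using d c by (simp add: d_eq norm_mult)
  then have "t = 1 \<or> t = -1" by linarith
  have S_eq: "S z = of_real (Re z) * c + of_real (Im z) * d" for z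
  proof -
    have "S z = S (Re z *\<^sub>R 1 + Im z *\<^sub>R \<i>)" by (simp add: scaleR_conv_of_real mult.commute complex_eq[symmetric])
    then show ?thesis
      unfolding linear_add[OF lin] linear_scale[OF lin] by (simp add: c_def d_def scaleR_conv_of_real)
  qed
  have S: "S z = c * Complex (Re z) (t * Im z)" for z
    by (simp add: S_eq d_eq complex_eq_iff algebra_simps)
  from \<open>t = 1 \<or> t = -1\<close> show ?thesis
  proof
    assume "t = 1"
    then have "S = (\<lambda>z. c * z)" by (auto simp: S complex_eq_iff)
    with c show ?thesis by (rule that(1))
  next
    assume "t = -1"
    then have "S = (\<lambda>z. c * cnj z)" by (auto simp: S complex_eq_iff)
    with c show ?thesis by (rule that(2))
  qed
qed

text \<open>The sign with which \<open>S\<close> commutes with \<i> is its determinant; conjugation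
  by \<open>S\<close> multiplies the parameter y by it.\<close>

lemma orthogonal_complex_ii:
  assumes "orthogonal_transformation S"
  obtains t :: real where "\<And>b. S (\<i> * b) = t *\<^sub>R (\<i> * S b)"
  using assms
proof (cases rule: orthogonal_complex_cases)
  case (1 c)
  then show ?thesis by (intro that[of 1]) simp
next
  case (2 c)
  then show ?thesis by (intro that[of "-1"]) simp
qed

definition O2_map :: "(complex \<Rightarrow> complex) \<Rightarrow> ambient \<Rightarrow> ambient" where
  "O2_map S = (\<lambda>(a, x, b). (S a, x, S b))"

lemma O2_eq: "O2 = {O2_map S | S. orthogonal_transformation S}"
proof (intro equalityI subsetI)
  fix f assume "f \<in> O2"
  then obtain S where S: "orthogonal_matrix S" and f: "f = block_affine S 0 0 0 0 1 0 0 0 0 S 0"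
    unfolding O2_def by blast
  have "orthogonal_transformation (\<lambda>x. S *v x)"
    using S by (simp add: orthogonal_transformation_matrix)
  then have "orthogonal_transformation (\<lambda>z. of_R2 (S *v to_R2 z))"
    using linear_compose[OF linear_compose[OF linear_to_R2 matrix_vector_mul_linear[of S]] linear_of_R2]
    by (simp add: orthogonal_transformation_def o_def flip: inner_to_R2)
  moreover have "f = O2_map (\<lambda>z. of_R2 (S *v to_R2 z))"
    by (auto simp: f block_affine_def O2_map_def)
  ultimately show "f \<in> {O2_map S | S. orthogonal_transformation S}" by blast
next
  fix f assume "f \<in> {O2_map S | S. orthogonal_transformation S}"
  then obtain S where S: "orthogonal_transformation S" and f: "f = O2_map S" by blast
  let ?T = "to_R2 \<circ> S \<circ> of_R2"
  have lin: "linear S" using S by (rule orthogonal_transformation_linear)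
  have T: "linear ?T"
    by (intro linear_compose linear_of_R2 linear_to_R2 lin)
  have "orthogonal_transformation ?T"
    using S T inner_to_R2[of "of_R2 _" "of_R2 _"] by (simp add: orthogonal_transformation_def)
  then have "orthogonal_matrix (matrix ?T)"
    by (simp add: orthogonal_transformation_matrix)
  moreover have "f = block_affine (matrix ?T) 0 0 0 0 1 0 0 0 0 (matrix ?T) 0"
    by (auto simp: f block_affine_def O2_map_def matrix_vector_mul(2)[OF T, THEN fun_cong])
  ultimately show "f \<in> O2" unfolding O2_def by blast
qed

lemma O2_map_comp: "O2_map S \<circ> O2_map T = O2_map (S \<circ> T)"
  by (auto simp: O2_map_def)

lemma O2_map_id: "O2_map id = id"
  by (auto simp: O2_map_def)

lemma subgroup_O2: "subgroup O2 (BijGroup UNIV)"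
proof (rule subgroup_BijGroup_UNIV_I)
  show "id \<in> O2"
    unfolding O2_eq
    by (intro CollectI exI[of _ id]) (simp add: O2_map_id orthogonal_transformation_def linear_id)
  show "f \<circ> g \<in> O2" if "f \<in> O2" "g \<in> O2" for f g
    using that unfolding O2_eq by (auto simp only: O2_map_comp intro: orthogonal_transformation_compose)
  show "\<exists>g\<in>O2. f \<circ> g = id \<and> g \<circ> f = id" if f: "f \<in> O2" for f
  proof -
    obtain S where S: "orthogonal_transformation S" "f = O2_map S" using f by (auto simp: O2_eq)
    have "S \<circ> inv_into UNIV S = id" "inv_into UNIV S \<circ> S = id"
      using orthogonal_transformation_bij[OF S(1)]
      by (simp_all add: bij_is_inj inv_o_cancel surj_iff[THEN iffD1, OF bij_is_surj])
    moreover have "O2_map (inv_into UNIV S) \<in> O2"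
      using orthogonal_transformation_inv[OF S(1)] by (auto simp: O2_eq)
    ultimately show ?thesis
      using S(2) by (intro bexI[of _ "O2_map (inv_into UNIV S)"]) (simp_all add: O2_map_comp O2_map_id)
  qed
qed

lemma O2_map_Ghat_map:
  assumes S: "orthogonal_transformation S" and t: "\<And>b. S (\<i> * b) = t *\<^sub>R (\<i> * S b)"
  shows "O2_map S \<circ> Ghat_map \<kappa> X y Z = Ghat_map \<kappa> (S X) (t * y) (S Z) \<circ> O2_map S"
proof -
  have lin: "linear S" and inn: "S v \<bullet> S w = v \<bullet> w" for v w
    using S by (auto simp: orthogonal_transformation_def)
  show ?thesis
    by (auto simp: O2_map_def Ghat_map_def linear_add[OF lin] linear_scale[OF lin] inn t)
qed

lemma O2_map_conj_Ghat:
  assumes "f \<in> O2" "g \<in> Ghat_matrices \<kappa>"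
  shows "\<exists>g'\<in>Ghat_matrices \<kappa>. f \<circ> g = g' \<circ> f"
proof -
  obtain S where S: "orthogonal_transformation S" "f = O2_map S" using assms(1) by (auto simp: O2_eq)
  obtain t where "\<And>b. S (\<i> * b) = t *\<^sub>R (\<i> * S b)" using S(1) by (rule orthogonal_complex_ii) blast
  moreover obtain X y Z where "g = Ghat_map \<kappa> X y Z" using assms(2) by (auto simp: Ghat_matrices_eq)
  ultimately have "f \<circ> g = Ghat_map \<kappa> (S X) (t * y) (S Z) \<circ> f"
    using O2_map_Ghat_map[OF S(1)] S(2) by simp
  then show ?thesis using Ghat_map_in by blast
qed

section \<open>Affine and extrinsic isometries\<close>

text \<open>A kernel vector would be orthogonal to everything; in finite dimension injectivity is
  enough for bijectivity.\<close>

lemma scalar_product_linear_isometry_inv: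
  assumes B: "scalar_product B" and A: "A \<in> linear_isometries B"
  shows "bij A" "inv_into UNIV A \<in> linear_isometries B"
proof -
  have lin: "linear A" and iso: "B (A v) (A w) = B v w" for v w
    using A by (auto simp: linear_isometries_def)
  have bl: "bilinear B" using B by (simp add: scalar_product_def)
  have "v = 0" if "A v = 0" for v
  proof -
    have "B v w = 0" for w
      using iso[of v w] by (simp add: that bilinear_lzero[OF bl])
    then show ?thesis using B by (auto simp: scalar_product_def)
  qed
  then have inj: "inj A" using lin by (simp add: linear_injective_0)
  then show bij: "bij A" using linear_injective_imp_surjective[OF lin] by (simp add: bij_def)
  have "B (inv_into UNIV A v) (inv_into UNIV A w) = B v w" for v w
    using iso[of "inv_into UNIV A v" "inv_into UNIV A w"] bij by (simp add: bij_is_surj surj_f_inv_f)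
  then show "inv_into UNIV A \<in> linear_isometries B"
    using inj_linear_imp_inv_linear[OF lin inj] by (simp add: linear_isometries_def)
qed

lemma subgroup_affine_isometries:
  assumes B: "scalar_product B"
  shows "subgroup (affine_isometries B) (BijGroup UNIV)"
proof (rule subgroup_BijGroup_UNIV_I)
  have "(\<lambda>w. w) \<in> linear_isometries B" by (simp add: linear_isometries_def linear_ident)
  then show "id \<in> affine_isometries B"
    unfolding affine_isometries_def by (intro CollectI exI[of _ "\<lambda>w. w"] exI[of _ 0]) auto
  show "f \<circ> g \<in> affine_isometries B" if fg: "f \<in> affine_isometries B" "g \<in> affine_isometries B" for f g
  proof -
    obtain A b A' b' where A: "f = (\<lambda>w. A w + b)" "A \<in> linear_isometries B"
      "g = (\<lambda>w. A' w + b')" "A' \<in> linear_isometries B"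
      using fg by (auto simp: affine_isometries_def)
    then have "linear A" by (simp add: linear_isometries_def)
    then have "f \<circ> g = (\<lambda>w. (A \<circ> A') w + (A b' + b))"
      by (auto simp: A linear_add)
    moreover have "A \<circ> A' \<in> linear_isometries B"
      using A by (auto simp: linear_isometries_def intro: linear_compose)
    ultimately show ?thesis unfolding affine_isometries_def by blast
  qed
  show "\<exists>g\<in>affine_isometries B. f \<circ> g = id \<and> g \<circ> f = id" if f: "f \<in> affine_isometries B" for f
  proof -
    obtain A b where A: "f = (\<lambda>w. A w + b)" "A \<in> linear_isometries B"
      using f by (auto simp: affine_isometries_def)
    note inv = scalar_product_linear_isometry_inv[OF B A(2)]
    have lin: "linear (inv_into UNIV A)" using inv(2) by (simp add: linear_isometries_def)
    let ?g = "\<lambda>w. inv_into UNIV A w + (- inv_into UNIV A b)"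
    have "?g \<in> affine_isometries B" unfolding affine_isometries_def using inv(2) by blast
    moreover have "f \<circ> ?g = id" "?g \<circ> f = id"
      using inv(1) by (auto simp: A bij_is_surj surj_f_inv_f bij_is_inj linear_add[OF lin] fun_eq_iff
          simp flip: linear_diff[OF lin] diff_conv_add_uminus)
    ultimately show ?thesis by blast
  qed
qed

lemma subgroup_extrinsic_isometries:
  assumes B: "scalar_product B"
  shows "subgroup (extrinsic_isometries B M) (BijGroup UNIV)"
proof (rule subgroup_BijGroup_UNIV_I)
  note sub = subgroup_affine_isometries[OF B]
  have id: "id \<in> affine_isometries B"
    using subgroup.one_closed[OF sub] by (simp add: one_BijGroup_UNIV)
  then show "id \<in> extrinsic_isometries B M" by (simp add: extrinsic_isometries_def)
  show "f \<circ> g \<in> extrinsic_isometries B M"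
    if "f \<in> extrinsic_isometries B M" "g \<in> extrinsic_isometries B M" for f g
    using that subgroup.m_closed[OF sub, of f g] subgroup_BijGroup_UNIV_bij[OF sub] image_comp[of f g M]
    by (simp add: extrinsic_isometries_def mult_BijGroup_UNIV)
  show "\<exists>g\<in>extrinsic_isometries B M. f \<circ> g = id \<and> g \<circ> f = id" if f: "f \<in> extrinsic_isometries B M" for f
  proof -
    have f': "f \<in> affine_isometries B" "f ` M = M" using f by (auto simp: extrinsic_isometries_def)
    have bij: "bij f" by (rule subgroup_BijGroup_UNIV_bij[OF sub f'(1)])
    have "inv_into UNIV f \<in> affine_isometries B"
      using subgroup.m_inv_closed[OF sub f'(1)] by (simp add: inv_BijGroup_UNIV[OF bij])
    moreover have "inv_into UNIV f ` M = M"
      using f'(2) bij by (metis bij_is_inj image_inv_f_f)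
    ultimately have "inv_into UNIV f \<in> extrinsic_isometries B M" by (simp add: extrinsic_isometries_def)
    moreover have "f \<circ> inv_into UNIV f = id" "inv_into UNIV f \<circ> f = id"
      using bij by (auto simp: bij_is_surj bij_is_inj surj_f_inv_f)
    ultimately show ?thesis by blast
  qed
qed

lemma Ghat_affine_isometries: "Ghat_matrices \<kappa> \<subseteq> affine_isometries (ambient_product \<kappa>)"
proof
  fix f assume "f \<in> Ghat_matrices \<kappa>"
  then obtain X y Z where f: "f = Ghat_map \<kappa> X y Z" by (auto simp: Ghat_matrices_eq)
  define A :: "ambient \<Rightarrow> ambient" where "A = (\<lambda>(a, x, b).
     (a + (\<kappa> * x - \<kappa> / 2 * (X \<bullet> b)) *\<^sub>R X + y *\<^sub>R (\<i> * b), x - X \<bullet> b, b))"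
  have "linear A"
    by (rule linearI) (auto simp: A_def algebra_simps add_divide_distrib)
  moreover have "ambient_product \<kappa> (A v) (A w) = ambient_product \<kappa> v w" for v w
    by (cases v; cases w) (simp add: A_def ambient_product_inner inner_complex_def field_simps)
  ultimately have "A \<in> linear_isometries (ambient_product \<kappa>)" by (simp add: linear_isometries_def)
  moreover have "f = (\<lambda>w. A w + (Z, - (X \<bullet> X) / 2, X))"
    by (auto simp: f A_def Ghat_map_def)
  ultimately show "f \<in> affine_isometries (ambient_product \<kappa>)"
    unfolding affine_isometries_def by blast
qed

lemma Ghat_image_ext_space:
  assumes "f \<in> Ghat_matrices \<kappa>" shows "f ` ext_space = ext_space"
  by (rule subgroup_BijGroup_UNIV_image[OF subgroup_Ghat assms])
    (auto simp: Ghat_matrices_eq Ghat_map_in_ext_space)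

lemma Ghat_extrinsic_isometries: "Ghat_matrices \<kappa> \<subseteq> extrinsic_isometries (ambient_product \<kappa>) ext_space"
  unfolding extrinsic_isometries_def using Ghat_affine_isometries Ghat_image_ext_space by blast

lemma O2_linear_isometries: "O2 \<subseteq> linear_isometries (ambient_product \<kappa>)"
proof
  fix f assume "f \<in> O2"
  then obtain S where S: "orthogonal_transformation S" "f = O2_map S" by (auto simp: O2_eq)
  have lin: "linear S" and inn: "S v \<bullet> S w = v \<bullet> w" for v w
    using S(1) by (auto simp: orthogonal_transformation_def)
  have "linear f"
    by (rule linearI) (auto simp: S(2) O2_map_def linear_add[OF lin] linear_scale[OF lin])
  then show "f \<in> linear_isometries (ambient_product \<kappa>)"
    by (auto simp: linear_isometries_def S(2) O2_map_def ambient_product_inner inn)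
qed

lemma O2_extrinsic_isometries: "O2 \<subseteq> extrinsic_isometries (ambient_product \<kappa>) ext_space"
proof
  fix f assume f: "f \<in> O2"
  have "f ` ext_space = ext_space"
    by (rule subgroup_BijGroup_UNIV_image[OF subgroup_O2 f])
      (auto simp: O2_eq O2_map_def mem_ext_space_iff orthogonal_transformation_def)
  moreover have "f \<in> affine_isometries (ambient_product \<kappa>)"
    unfolding affine_isometries_def using f O2_linear_isometries
    by (intro CollectI exI[of _ f] exI[of _ 0]) auto
  ultimately show "f \<in> extrinsic_isometries (ambient_product \<kappa>) ext_space"
    by (simp add: extrinsic_isometries_def)
qed

section \<open>Determinants\<close>

lemma to_vec_nth [simp]:
  "to_vec w $ Inl j = to_R2 (fst w) $ j" "to_vec w $ Inr (Inl k) = fst (snd w)"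
  "to_vec w $ Inr (Inr j) = to_R2 (snd (snd w)) $ j"
  by (simp_all add: to_vec_def split: prod.splits)

lemma to_vec_of_vec [simp]: "to_vec (of_vec w) = w" "of_vec (to_vec v) = v"
proof -
  show "to_vec (of_vec w) = w"
    by (simp add: vec_eq_iff split_sum_all of_vec_def forall_1 of_R2_def forall_2)
  show "of_vec (to_vec v) = v"
    by (cases v) (simp add: of_vec_def of_R2_def complex_eq_iff)
qed

lemma linear_to_vec: "linear to_vec" and linear_of_vec: "linear of_vec"
proof -
  show "linear to_vec"
    by (rule linearI) (simp_all add: vec_eq_iff split_sum_all forall_2)
  show "linear of_vec"
    by (rule linearI) (simp_all add: of_vec_def of_R2_def complex_eq_iff)
qed

definition O2_det :: "(complex \<Rightarrow> complex) \<Rightarrow> real" where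
  "O2_det S = det (matrix (to_vec \<circ> O2_map S \<circ> of_vec))"

lemma linear_O2_map: "linear S \<Longrightarrow> linear (O2_map S)"
  by (rule linearI) (auto simp: O2_map_def linear_add linear_scale)

lemma O2_det_comp:
  assumes "linear S" "linear T" shows "O2_det (S \<circ> T) = O2_det S * O2_det T"
proof -
  have lin: "linear (to_vec \<circ> O2_map S \<circ> of_vec)" if "linear S" for S
    by (intro linear_compose linear_to_vec linear_of_vec linear_O2_map that)
  have "to_vec \<circ> O2_map (S \<circ> T) \<circ> of_vec = (to_vec \<circ> O2_map S \<circ> of_vec) \<circ> (to_vec \<circ> O2_map T \<circ> of_vec)"
    by (simp add: fun_eq_iff flip: O2_map_comp)
  then show ?thesis
    unfolding O2_det_def by (simp only: matrix_compose[OF lin[OF assms(2)] lin[OF assms(1)]] det_mul)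
qed

lemma O2_det_id: "O2_det id = 1"
proof -
  have "to_vec \<circ> O2_map id \<circ> of_vec = id" by (auto simp: O2_map_def)
  then show ?thesis by (simp add: O2_det_def matrix_id_mat_1)
qed

text \<open>In the standard basis the matrix is diag(1, -1, 1, 1, -1). The sign occurs twice because
  both complex summands are reflected, which is why even the reflections of O(2) have determinant 1
  here.\<close>

lemma O2_det_cnj: "O2_det cnj = 1"
proof -
  let ?A = "matrix (to_vec \<circ> O2_map cnj \<circ> of_vec)"
  have "det ?A = prod (\<lambda>i. ?A $ i $ i) UNIV"
  proof (rule det_diagonal)
    have "\<forall>i j. i \<noteq> j \<longrightarrow> ?A $ i $ j = 0"
      by (simp add: split_sum_all forall_1 forall_2 matrix_def of_vec_def axis_def O2_map_def of_R2_def)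
    then show "?A $ i $ j = 0" if "i \<noteq> j" for i j using that by blast
  qed
  also have "\<dots> = 1"
    unfolding UNIV_Plus_UNIV[symmetric]
    by (simp add: prod.Plus UNIV_2 matrix_def of_vec_def axis_def O2_map_def of_R2_def)
  finally show ?thesis by (simp add: O2_det_def)
qed

text \<open>Conjugation turns the rotation by e into its inverse, so the determinant of a rotation is its
  own inverse; and every rotation is the square of a rotation.\<close>

lemma O2_det_rotation:
  assumes "cmod c = 1" shows "O2_det (\<lambda>z. c * z) = 1"
proof -
  define e where "e = csqrt c"
  have e1: "e * e = c" by (simp add: e_def flip: power2_eq_square)
  then have "cmod e ^ 2 = 1" using assms by (metis norm_mult power2_eq_square)
  then have e2: "cnj e * e = 1"
    by (metis complex_norm_square mult.commute of_real_1)
  have lin: "linear (\<lambda>z. d * z)" "linear cnj" for d :: complex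
    by (auto intro!: linearI simp: algebra_simps)
  have "(\<lambda>z. cnj e * z) = cnj \<circ> (\<lambda>z. e * z) \<circ> cnj" by (simp add: fun_eq_iff)
  then have "O2_det (\<lambda>z. cnj e * z) = O2_det (\<lambda>z. e * z)"
    by (simp add: O2_det_comp linear_compose lin O2_det_cnj del: o_apply)
  moreover have "(\<lambda>z. cnj e * z) \<circ> (\<lambda>z. e * z) = id"
    by (simp add: fun_eq_iff e2 flip: mult.assoc)
  then have "O2_det (\<lambda>z. cnj e * z) * O2_det (\<lambda>z. e * z) = 1"
    using O2_det_comp[OF lin(1) lin(1), of "cnj e" e] O2_det_id by simp
  moreover have "(\<lambda>z. e * z) \<circ> (\<lambda>z. e * z) = (\<lambda>z. c * z)"
    by (simp add: fun_eq_iff e1 flip: mult.assoc)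
  then have "O2_det (\<lambda>z. c * z) = O2_det (\<lambda>z. e * z) * O2_det (\<lambda>z. e * z)"
    using O2_det_comp[OF lin(1) lin(1), of e e] by simp
  ultimately show ?thesis by simp
qed

lemma O2_special_isometries: "O2 \<subseteq> special_isometries \<kappa>"
proof
  fix f assume f: "f \<in> O2"
  then obtain S where S: "orthogonal_transformation S" "f = O2_map S" by (auto simp: O2_eq)
  have "O2_det S = 1"
    using S(1)
  proof (cases rule: orthogonal_complex_cases)
    case (1 c)
    then show ?thesis by (simp add: O2_det_rotation)
  next
    case (2 c)
    have "S = (\<lambda>z. c * z) \<circ> cnj" using 2 by auto
    moreover have "linear (\<lambda>z. c * z)" "linear cnj"
      by (auto intro!: linearI simp: algebra_simps)
    ultimately show ?thesis using O2_det_rotation[OF 2(1)] O2_det_cnj by (simp add: O2_det_comp del: o_apply)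
  qed
  then show "f \<in> special_isometries \<kappa>"
    using O2_linear_isometries f by (auto simp: special_isometries_def O2_det_def S(2))
qed

section \<open>The group of extrinsic isometries\<close>

text \<open>The block columns of \<open>A\<close> are P with zeros below it, then (c, d, e), then
  (Q, l, R). Comparing degrees in the equation of M and using orthogonality relations shows that e,
  l, c vanish and d = 1; the isometry identity then ties P and Q to R.\<close>

lemma linear_extrinsic_isometry:
  assumes \<kappa>: "\<kappa> \<noteq> 0" and A: "A \<in> linear_isometries (ambient_product \<kappa>)" and M: "A ` ext_space \<subseteq> ext_space"
  obtains S y where "orthogonal_transformation S" "A = O2_map S \<circ> Ghat_map \<kappa> 0 y 0"
proof -
  have lin: "linear A" and iso: "ambient_product \<kappa> (A v) (A w) = ambient_product \<kappa> v w" for v w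
    using A unfolding linear_isometries_def by blast+
  note A_add = linear_add[OF lin] and A_scale = linear_scale[OF lin]
  have M': "fst (snd (A w)) = - (1/2) * (snd (snd (A w)) \<bullet> snd (snd (A w)))" if "w \<in> ext_space" for w
    using M that by (subst mem_ext_space_iff[symmetric]) blast
  define P where "P a = fst (A (a, 0, 0))" for a
  define Q where "Q b = fst (A (0, 0, b))" for b
  define l where "l b = fst (snd (A (0, 0, b)))" for b
  define R where "R b = snd (snd (A (0, 0, b)))" for b
  define c d e where "c = fst (A (0, 1, 0))" and "d = fst (snd (A (0, 1, 0)))" and "e = snd (snd (A (0, 1, 0)))"
  have linP: "linear P" and linQ: "linear Q" and linR: "linear R"
    by (rule linearI; simp add: P_def Q_def R_def flip: A_add A_scale fst_add snd_add fst_scaleR snd_scaleR)+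
  have Ab: "A (0, 0, b) = (Q b, l b, R b)" for b
    by (simp add: Q_def l_def R_def prod_eq_iff)
  have Ac: "A (0, 1, 0) = (c, d, e)"
    by (simp add: c_def d_def e_def prod_eq_iff)
  have Aa: "A (a, 0, 0) = (P a, 0, 0)" for a
  proof -
    \<comment> \<open>All \<open>(a, 0, 0)\<close> lie in M. The real coordinate of their images is
      linear in \<open>a\<close>, but the equation of M makes it quadratic; comparing
      \<open>a\<close> with its double leaves only 0.\<close>
    have "A (2 *\<^sub>R a, 0, 0) = 2 *\<^sub>R A (a, 0, 0)" by (simp flip: A_scale)
    then have "snd (snd (A (a, 0, 0))) \<bullet> snd (snd (A (a, 0, 0))) = 0"
      using M'[of "(a, 0, 0)"] M'[of "(2 *\<^sub>R a, 0, 0)"] by (simp add: mem_ext_space_iff)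
    then have "snd (snd (A (a, 0, 0))) = 0" by simp
    moreover from this have "fst (snd (A (a, 0, 0))) = 0"
      using M'[of "(a, 0, 0)"] by (simp add: mem_ext_space_iff)
    ultimately show ?thesis by (simp add: P_def prod_eq_iff)
  qed
  have PR: "P a \<bullet> R b = a \<bullet> b" for a b
    using iso[of "(a, 0, 0)" "(0, 0, b)"] by (simp add: Aa Ab ambient_product_inner)
  have "surj P"
  proof (rule linear_injective_imp_surjective[OF linP])
    have "a = 0" if "P a = 0" for a
      using PR[of a a] that by simp
    then show "inj P" by (simp add: linear_injective_0[OF linP])
  qed (rule refl)
  have e: "e = 0"
  proof -
    \<comment> \<open>\<open>(0, 1, 0)\<close> is orthogonal to all \<open>(a, 0, 0)\<close>, so
      \<open>e\<close> is orthogonal to the image of \<open>P\<close>, which is everything.\<close>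
    obtain a where "e = P a" using \<open>surj P\<close> by (rule surjE)
    then show ?thesis
      using iso[of "(a, 0, 0)" "(0, 1, 0)"] by (simp add: Aa Ac ambient_product_inner)
  qed
  have d2: "d * d = 1"
    using iso[of "(0, 1, 0)" "(0, 1, 0)"] \<kappa> by (simp add: Ac e ambient_product_inner)
  have sphere: "d * (b \<bullet> b) - 2 * l b = R b \<bullet> R b" for b
  proof -
    have "A (0, - (1/2) * (b \<bullet> b), b) = A ((- (1/2) * (b \<bullet> b)) *\<^sub>R (0, 1, 0) + (0, 0, b))" by simp
    also have "\<dots> = (- (1/2) * (b \<bullet> b)) *\<^sub>R (c, d, e) + (Q b, l b, R b)"
      by (simp only: A_add A_scale Ac Ab)
    finally have "A (0, - (1/2) * (b \<bullet> b), b) = (- (1/2) * (b \<bullet> b)) *\<^sub>R (c, d, e) + (Q b, l b, R b)" .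
    then show ?thesis
      using M'[of "(0, - (1/2) * (b \<bullet> b), b)"] by (simp add: mem_ext_space_iff e field_simps)
  qed
  have l: "l b = 0" for b
  proof -
    \<comment> \<open>In \<open>sphere\<close> the term with \<open>l\<close> is odd in
      \<open>b\<close> and all others are even.\<close>
    have "A (0, 0, - b) = - A (0, 0, b)" by (simp flip: linear_neg[OF lin])
    then have "R (- b) = - R b" "l (- b) = - l b" by (simp_all add: Ab)
    then show ?thesis using sphere[of b] sphere[of "- b"] by simp
  qed
  have "(1 :: complex) \<bullet> 1 = 1" by simp
  \<comment> \<open>The inner product on the complex summand is positive, which excludes d = -1:
    that sign would turn the paraboloid over.\<close>
  then have "d = R 1 \<bullet> R 1" using sphere[of 1] l[of 1] by simp
  then have "d \<ge> 0" by simp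
  with d2 have d: "d = 1" by (simp add: square_eq_1_iff)
  have R: "orthogonal_transformation R"
    using sphere linR by (simp add: orthogonal_transformation d l norm_eq_sqrt_inner)
  have inn: "R v \<bullet> R w = v \<bullet> w" for v w using R by (simp add: orthogonal_transformation_def)
  have bijR: "bij R" using R by (rule orthogonal_transformation_bij)
  have R_ext: "v = w" if "\<And>b. v \<bullet> R b = w \<bullet> R b" for v w
  proof -
    obtain b where b: "v - w = R b" using bij_is_surj[OF bijR] by (rule surjE)
    have "(v - w) \<bullet> R b = 0" using that[of b] by (simp add: inner_diff_left)
    then have "v - w = 0" by (simp only: b inner_eq_zero_iff)
    then show ?thesis by simp
  qed
  have P: "P a = R a" for a by (rule R_ext) (simp add: PR inn)
  have c: "c = 0"
  proof (rule R_ext)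
    show "c \<bullet> R b = 0 \<bullet> R b" for b
      using iso[of "(0, 1, 0)" "(0, 0, b)"] by (simp add: Ac Ab e l ambient_product_inner)
  qed
  \<comment> \<open>Factoring \<open>R\<close> out of \<open>Q\<close> turns the isotropy of the
    space of all \<open>(0, 0, b)\<close> into skewness of \<open>T\<close>, and a skew map of the
    plane is a multiple of multiplication by \<i>.\<close>
  define T where "T b = inv_into UNIV R (Q b)" for b
  have QT: "Q b = R (T b)" for b by (simp add: T_def surj_f_inv_f bij_is_surj[OF bijR])
  have skew: "T b \<bullet> b' + b \<bullet> T b' = 0" for b b'
    using iso[of "(0, 0, b)" "(0, 0, b')"] by (simp add: Ab l ambient_product_inner QT inn)
  have linT: "linear T"
    by (rule linearI; rule injD[OF bij_is_inj[OF bijR]])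
      (simp_all add: linear_add[OF linR] linear_scale[OF linR] linear_add[OF linQ] linear_scale[OF linQ] flip: QT)
  define y where "y = Im (T 1)"
  have T: "T b = y *\<^sub>R (\<i> * b)" for b
  proof -
    have "b = Re b *\<^sub>R 1 + Im b *\<^sub>R \<i>" by (simp add: complex_eq_iff)
    then have "T b = Re b *\<^sub>R T 1 + Im b *\<^sub>R T \<i>"
      by (metis linear_add[OF linT] linear_scale[OF linT])
    moreover have "Re (T 1) = 0" "Im (T \<i>) = 0" "Re (T \<i>) = - y"
      using skew[of 1 1] skew[of \<i> \<i>] skew[of 1 \<i>] by (simp_all add: inner_complex_def y_def)
    ultimately show ?thesis by (simp add: complex_eq_iff flip: y_def)
  qed
  have "A = O2_map R \<circ> Ghat_map \<kappa> 0 y 0"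
  proof
    fix w :: ambient
    obtain a x b where w: "w = (a, x, b)" by (metis prod.exhaust)
    have "w = (a, 0, 0) + x *\<^sub>R (0, 1, 0) + (0, 0, b)" by (simp add: w)
    then have "A w = A (a, 0, 0) + x *\<^sub>R A (0, 1, 0) + A (0, 0, b)" by (simp only: A_add A_scale)
    then show "A w = (O2_map R \<circ> Ghat_map \<kappa> 0 y 0) w"
      by (simp add: Aa Ac Ab P c d e l QT T w O2_map_def Ghat_map_def linear_add[OF linR])
  qed
  with R show ?thesis by (rule that)
qed

lemma extrinsic_isometry_decomposition:
  assumes \<kappa>: "\<kappa> \<noteq> 0" and F: "F \<in> extrinsic_isometries (ambient_product \<kappa>) ext_space"
  shows "\<exists>f\<in>O2. \<exists>g\<in>Ghat_matrices \<kappa>. F = f \<circ> g"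
proof -
  note B = scalar_product_ambient_product[OF \<kappa>]
  note sub = subgroup_extrinsic_isometries[OF B, of ext_space]
  define p where "p = F 0"
  have p: "p \<in> ext_space" using F zero_in_ext_space unfolding p_def extrinsic_isometries_def by blast
  \<comment> \<open>With y = 0 the origin goes to \<open>(Z, - (X \<bullet> X) / 2, X)\<close>, so
    the complex components of \<open>p\<close> serve as Z and X.\<close>
  define g where "g = Ghat_map \<kappa> (snd (snd p)) 0 (fst p)"
  have g0: "g 0 = p"
    using p by (auto simp: g_def Ghat_map_def zero_prod_def mem_ext_space_iff prod_eq_iff)
  \<comment> \<open>The zeros are left unsimplified to match \<open>Ghat_map_inverse\<close> at y =
    0 literally.\<close>
  define g' where "g' = Ghat_map \<kappa> (- snd (snd p)) (- 0) (0 *\<^sub>R (\<i> * snd (snd p)) - fst p)"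
  have g': "g' \<in> Ghat_matrices \<kappa>" "g' \<circ> g = id" "g \<circ> g' = id"
    unfolding g_def g'_def by (rule Ghat_map_in Ghat_map_inverse)+
  have "g' \<in> extrinsic_isometries (ambient_product \<kappa>) ext_space"
    using g'(1) Ghat_extrinsic_isometries by blast
  from subgroup_BijGroup_UNIV_comp[OF sub this F]
  obtain A b where A: "A \<in> linear_isometries (ambient_product \<kappa>)" and gF: "g' \<circ> F = (\<lambda>w. A w + b)"
    and M: "(g' \<circ> F) ` ext_space = ext_space"
    unfolding extrinsic_isometries_def affine_isometries_def by blast
  have "(g' \<circ> F) 0 = 0" using fun_cong[OF g'(2), of 0] by (simp add: g0 p_def)
  moreover have "A 0 = 0" using A by (simp add: linear_isometries_def linear_0)
  ultimately have "b = 0" by (simp add: gF)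
  then have gF: "g' \<circ> F = A" by (simp add: gF)
  have "A ` ext_space \<subseteq> ext_space" using M by (simp add: gF)
  from linear_extrinsic_isometry[OF \<kappa> A this]
  obtain S y where S: "orthogonal_transformation S" "A = O2_map S \<circ> Ghat_map \<kappa> 0 y 0" .
  have S_in: "O2_map S \<in> O2" using S(1) by (auto simp: O2_eq)
  define S' where "S' = inv_into UNIV (O2_map S)"
  have bij_S: "bij (O2_map S)" by (rule subgroup_BijGroup_UNIV_bij[OF subgroup_O2 S_in])
  have S': "S' \<in> O2" "S' \<circ> O2_map S = id" "O2_map S \<circ> S' = id"
    using subgroup.m_inv_closed[OF subgroup_O2 S_in] bij_S
    by (simp_all add: S'_def inv_BijGroup_UNIV bij_is_inj inv_o_cancel surj_iff[THEN iffD1, OF bij_is_surj])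
  obtain h where h: "h \<in> Ghat_matrices \<kappa>" "S' \<circ> g = h \<circ> S'"
    using O2_map_conj_Ghat[OF S'(1), of g \<kappa>] by (auto simp: g_def)
  \<comment> \<open>F is \<open>g\<close> followed on the right by \<open>A\<close>. The orthogonal
    factor of \<open>A\<close> is moved to the left of \<open>g\<close>, which replaces
    \<open>g\<close> by its conjugate \<open>h\<close>.\<close>
  have "F = (g \<circ> g') \<circ> F" by (simp add: g'(3))
  also have "\<dots> = (O2_map S \<circ> S') \<circ> g \<circ> (g' \<circ> F)" by (simp only: S'(3) id_comp comp_assoc)
  also have "\<dots> = O2_map S \<circ> (S' \<circ> g) \<circ> (O2_map S \<circ> Ghat_map \<kappa> 0 y 0)" by (simp only: gF S(2) comp_assoc)
  also have "\<dots> = O2_map S \<circ> h \<circ> (S' \<circ> O2_map S) \<circ> Ghat_map \<kappa> 0 y 0" by (simp only: h(2) comp_assoc)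
  also have "\<dots> = O2_map S \<circ> (h \<circ> Ghat_map \<kappa> 0 y 0)" by (simp only: S'(2) comp_id comp_assoc)
  finally have "F = O2_map S \<circ> (h \<circ> Ghat_map \<kappa> 0 y 0)" .
  moreover have "h \<circ> Ghat_map \<kappa> 0 y 0 \<in> Ghat_matrices \<kappa>"
    by (rule subgroup_BijGroup_UNIV_comp[OF subgroup_Ghat h(1) Ghat_map_in])
  ultimately show ?thesis using S_in by blast
qed

lemma O2_inter_Ghat: "O2 \<inter> Ghat_matrices \<kappa> = {id}"
proof (intro equalityI subsetI)
  fix f assume "f \<in> O2 \<inter> Ghat_matrices \<kappa>"
  then obtain S X y Z where S: "f = O2_map S" "orthogonal_transformation S" "f = Ghat_map \<kappa> X y Z"
    by (auto simp: O2_eq Ghat_matrices_eq)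
  have "S 0 = 0" using S(2) by (simp add: orthogonal_transformation_linear linear_0)
  then have "X = 0"
    using fun_cong[OF S(1), of 0] fun_cong[OF S(3), of 0] by (simp add: O2_map_def Ghat_map_def zero_prod_def)
  then have "S b = b" for b
    using fun_cong[OF S(1), of "(0, 0, b)"] fun_cong[OF S(3), of "(0, 0, b)"] by (simp add: O2_map_def Ghat_map_def)
  then show "f \<in> {id}" by (auto simp: S(1) O2_map_def)
next
  fix f :: "ambient \<Rightarrow> ambient" assume "f \<in> {id}"
  then show "f \<in> O2 \<inter> Ghat_matrices \<kappa>"
    using subgroup.one_closed[OF subgroup_O2] subgroup.one_closed[OF subgroup_Ghat, of \<kappa>]
    by (simp add: one_BijGroup_UNIV)
qed

lemma semidirect_product_extrinsic_isometries:
  assumes \<kappa>: "\<kappa> \<noteq> 0"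
  shows "semidirect_product
    (transformation_group (extrinsic_isometries (ambient_product \<kappa>) ext_space)) O2 (Ghat_matrices \<kappa>)"
proof -
  define E where "E = extrinsic_isometries (ambient_product \<kappa>) ext_space"
  have E: "subgroup E (BijGroup UNIV)"
    unfolding E_def by (rule subgroup_extrinsic_isometries[OF scalar_product_ambient_product[OF \<kappa>]])
  have O2: "O2 \<subseteq> E" and Gh: "Ghat_matrices \<kappa> \<subseteq> E"
    unfolding E_def by (rule O2_extrinsic_isometries Ghat_extrinsic_isometries)+
  have bij: "bij f" if "f \<in> E" for f by (rule subgroup_BijGroup_UNIV_bij[OF E that])
  have mult: "f \<otimes>\<^bsub>transformation_group E\<^esub> g = f \<circ> g" if "f \<in> E" "g \<in> E" for f g
    using that bij by (simp add: transformation_group_simps mult_BijGroup_UNIV)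
  have comp_E: "f \<circ> g \<in> E" if "f \<in> E" "g \<in> E" for f g
    by (rule subgroup_BijGroup_UNIV_comp[OF E that])
  have comp_Gh: "f \<circ> g \<in> Ghat_matrices \<kappa>" if "f \<in> Ghat_matrices \<kappa>" "g \<in> Ghat_matrices \<kappa>" for f g
    by (rule subgroup_BijGroup_UNIV_comp[OF subgroup_Ghat that])
  have inv_Gh: "inv_into UNIV f \<in> Ghat_matrices \<kappa>" if "f \<in> Ghat_matrices \<kappa>" for f
    by (rule subgroup_BijGroup_UNIV_inv[OF subgroup_Ghat that])
  have decomp: "\<exists>f\<in>O2. \<exists>g\<in>Ghat_matrices \<kappa>. F = f \<circ> g" if "F \<in> E" for F
    using that unfolding E_def by (rule extrinsic_isometry_decomposition[OF \<kappa>])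
  have "Ghat_matrices \<kappa> \<lhd> transformation_group E"
  proof (rule group.normal_invI[OF group_transformation_group[OF E]])
    show "subgroup (Ghat_matrices \<kappa>) (transformation_group E)"
      by (rule subgroup_transformation_group[OF E subgroup_Ghat Gh])
    fix F h assume "F \<in> carrier (transformation_group E)" and h: "h \<in> Ghat_matrices \<kappa>"
    then have F: "F \<in> E" by (simp add: transformation_group_simps)
    obtain f g where fg: "f \<in> O2" "g \<in> Ghat_matrices \<kappa>" "F = f \<circ> g" using decomp[OF F] by blast
    have bij_fg: "bij f" "bij g" using bij[OF subsetD[OF O2 fg(1)]] bij[OF subsetD[OF Gh fg(2)]] .
    have inv_F: "inv_into UNIV F \<in> E" by (rule subgroup_BijGroup_UNIV_inv[OF E F])
    \<comment> \<open>Conjugation by F is split: by \<open>g\<close> it stays in the matrix group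
      trivially, and by \<open>f\<close> because O(2) normalizes that group.\<close>
    have "g \<circ> h \<circ> inv_into UNIV g \<in> Ghat_matrices \<kappa>" by (intro comp_Gh inv_Gh fg(2) h)
    from O2_map_conj_Ghat[OF fg(1) this]
    obtain h' where h': "h' \<in> Ghat_matrices \<kappa>" "f \<circ> (g \<circ> h \<circ> inv_into UNIV g) = h' \<circ> f" ..
    have "F \<circ> h \<circ> inv_into UNIV F = (f \<circ> (g \<circ> h \<circ> inv_into UNIV g)) \<circ> inv_into UNIV f"
      by (simp only: fg(3) o_inv_distrib[OF bij_fg] comp_assoc)
    also have "\<dots> = h' \<circ> (f \<circ> inv_into UNIV f)" by (simp only: h'(2)) (simp only: comp_assoc)
    also have "\<dots> = h'" using bij_fg(1) by (simp add: surj_iff[THEN iffD1, OF bij_is_surj])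
    finally have "F \<circ> h \<circ> inv_into UNIV F \<in> Ghat_matrices \<kappa>" using h'(1) by (simp only:)
    then show "F \<otimes>\<^bsub>transformation_group E\<^esub> h \<otimes>\<^bsub>transformation_group E\<^esub> inv\<^bsub>transformation_group E\<^esub> F \<in> Ghat_matrices \<kappa>"
      using F inv_F comp_E subsetD[OF Gh h] by (simp only: inv_transformation_group[OF E F] mult)
  qed
  moreover have "O2 <#>\<^bsub>transformation_group E\<^esub> Ghat_matrices \<kappa> = E"
  proof (intro equalityI subsetI)
    fix F assume "F \<in> O2 <#>\<^bsub>transformation_group E\<^esub> Ghat_matrices \<kappa>"
    then obtain f g where "f \<in> O2" "g \<in> Ghat_matrices \<kappa>" "F = f \<otimes>\<^bsub>transformation_group E\<^esub> g"
      unfolding set_mult_def by blast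
    then show "F \<in> E" by (simp add: mult comp_E subsetD[OF O2] subsetD[OF Gh])
  next
    fix F assume "F \<in> E"
    then obtain f g where "f \<in> O2" "g \<in> Ghat_matrices \<kappa>" "F = f \<circ> g" using decomp by blast
    moreover from this have "F = f \<otimes>\<^bsub>transformation_group E\<^esub> g"
      by (simp add: mult subsetD[OF O2] subsetD[OF Gh])
    ultimately show "F \<in> O2 <#>\<^bsub>transformation_group E\<^esub> Ghat_matrices \<kappa>"
      unfolding set_mult_def by blast
  qed
  ultimately show ?thesis
    unfolding semidirect_product_def E_def[symmetric] transformation_group_simps
    by (simp add: subgroup_transformation_group[OF E subgroup_O2 O2] O2_inter_Ghat)
qed

section \<open>The isometry iota\<close>

lemma frechet_derivative_smooth_compose:
  fixes g :: "'a::real_normed_vector \<Rightarrow> 'b::euclidean_space"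
  assumes "smooth_on f UNIV" "smooth_on g UNIV"
  shows "frechet_derivative (f \<circ> g) (at x) v = frechet_derivative f (at (g x)) (frechet_derivative g (at x) v)"
proof -
  have "(f \<circ> g has_derivative frechet_derivative f (at (g x)) \<circ> frechet_derivative g (at x)) (at x)"
    by (intro diff_chain_at smooth_on_frechet_derivative assms)
  then show ?thesis by (simp add: frechet_derivative_at[symmetric])
qed

lemma iota_eq: "iota \<kappa> = (\<lambda>\<xi>. (fst \<xi> + (- \<kappa> / 4 * (snd \<xi> \<bullet> snd \<xi>)) *\<^sub>R snd \<xi>,
    - (1/2) * (snd \<xi> \<bullet> snd \<xi>), snd \<xi>))"
  by (auto simp: iota_def scaleR_conv_of_real power2_norm_eq_inner)

lemma snd_snd_iota [simp]: "snd (snd (iota \<kappa> \<xi>)) = snd \<xi>"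
  by (simp add: iota_eq)

text \<open>Polynomial on the whole ambient space, hence a smooth extension of the inverse of
  \<open>iota\<close> as smoothness on a subset requires.\<close>

definition iota_inv :: "real \<Rightarrow> ambient \<Rightarrow> complex \<times> complex" where
  "iota_inv \<kappa> w = (fst w + (\<kappa> / 4 * (snd (snd w) \<bullet> snd (snd w))) *\<^sub>R snd (snd w), snd (snd w))"

lemma iota_inv_iota [simp]: "iota_inv \<kappa> (iota \<kappa> \<xi>) = \<xi>"
  by (simp add: iota_eq iota_inv_def prod_eq_iff)

lemma iota_iota_inv [simp]: "w \<in> ext_space \<Longrightarrow> iota \<kappa> (iota_inv \<kappa> w) = w"
  by (simp add: iota_eq iota_inv_def prod_eq_iff mem_ext_space_iff)

lemma iota_in_ext_space [simp]: "iota \<kappa> \<xi> \<in> ext_space"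
  by (simp add: iota_eq mem_ext_space_iff)

lemma smooth_iota: "smooth_on (iota \<kappa>) UNIV"
  unfolding iota_eq smooth_on_def by (intro allI Ck_on_intros Ck_on_projections)

lemma smooth_iota_inv: "smooth_on (iota_inv \<kappa>) UNIV"
  unfolding iota_inv_def[abs_def] smooth_on_def by (intro allI Ck_on_intros Ck_on_projections)

lemma frechet_derivative_iota:
  "frechet_derivative (iota \<kappa>) (at \<xi>) = (\<lambda>v.
     (fst v - (\<kappa> / 2 * (snd \<xi> \<bullet> snd v)) *\<^sub>R snd \<xi> - (\<kappa> / 4 * (snd \<xi> \<bullet> snd \<xi>)) *\<^sub>R snd v,
      - (snd \<xi> \<bullet> snd v), snd v))"
  unfolding iota_eq
  by (rule frechet_derivative_at[symmetric])
    (auto intro!: derivative_eq_intros simp: fun_eq_iff inner_commute algebra_simps)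

text \<open>This explains the factor 1/4 in \<open>iota\<close>. The derivative of its cubic term
  contributes - \<kappa> (\<xi>2 \<bullet> v2) (\<xi>2 \<bullet> w2), which the real coordinate
  cancels, and - \<kappa>/2 |\<xi>2|^2 (v2 \<bullet> w2), the correction term of the metric.\<close>

lemma ambient_product_iota:
  "ambient_product \<kappa> (frechet_derivative (iota \<kappa>) (at \<xi>) v) (frechet_derivative (iota \<kappa>) (at \<xi>) w)
    = N_metric \<kappa> \<xi> v w"
  by (simp add: frechet_derivative_iota ambient_product_inner N_metric_inner inner_commute algebra_simps)

lemma bij_betw_iota: "bij_betw (iota \<kappa>) UNIV ext_space"
  by (rule bij_betwI[where g = "iota_inv \<kappa>"]) auto

lemma isometry_onto_iota: "isometry_onto (N_metric \<kappa>) ext_space (\<lambda>_. ambient_product \<kappa>) (iota \<kappa>)"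
proof -
  have "iota_inv \<kappa> y = inv_into UNIV (iota \<kappa>) y" if "y \<in> ext_space" for y
    using that by (metis UNIV_I bij_betw_imp_inj_on bij_betw_iota inv_into_f_f iota_iota_inv)
  then have "smooth_map_on (inv_into UNIV (iota \<kappa>)) ext_space"
    unfolding smooth_map_on_def using smooth_iota_inv by (intro ballI exI[of _ UNIV] exI[of _ "iota_inv \<kappa>"]) simp
  then show ?thesis
    by (simp add: isometry_onto_def smooth_iota bij_betw_iota ambient_product_iota)
qed

lemma N_isometry_onto_ext_space:
  "N_isometry_onto \<kappa> ext_space (\<lambda>_. ambient_product \<kappa>) (iota \<kappa> \<circ> N_coords \<kappa>)"
proof -
  \<comment> \<open>A section of the projection: the representative of a coset with vanishing
    \<open>a0\<close> part, where the factor -\<kappa>/12 undoes the cubic term of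
    \<open>N_lift_coords\<close>.\<close>
  define \<tau> :: "complex \<times> complex \<Rightarrow> ghat"
    where "\<tau> = (\<lambda>\<xi>. (fst \<xi> + (- \<kappa> / 12 * (snd \<xi> \<bullet> snd \<xi>)) *\<^sub>R snd \<xi>, 0, snd \<xi>))"
  have \<tau>: "N_lift_coords \<kappa> (\<tau> \<xi>) = \<xi>" for \<xi>
    by (cases \<xi>) (simp add: N_lift_coords_alt \<tau>_def)
  have smooth: "smooth_on \<tau> UNIV"
    unfolding \<tau>_def smooth_on_def by (intro allI Ck_on_intros Ck_on_projections)
  note N = N_coords_isometry[of \<kappa>, unfolded N_isometry_onto_def]
  have comp: "N_coords \<kappa> \<circ> coset_proj \<kappa> = N_lift_coords \<kappa>"
    by (auto simp: N_coords_coset_proj)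
  note metric = N[THEN conjunct2, THEN conjunct2, THEN conjunct2, rule_format, unfolded comp N_coords_coset_proj]
  show ?thesis
    unfolding N_isometry_onto_def
  proof (intro conjI ballI allI)
    show "bij_betw (iota \<kappa> \<circ> N_coords \<kappa>) (N_space \<kappa>) ext_space"
      using N bij_betw_iota by (blast intro: bij_betw_trans)
    show "smooth_on (iota \<kappa> \<circ> N_coords \<kappa> \<circ> coset_proj \<kappa>) UNIV"
      unfolding comp_assoc comp by (intro smooth_on_compose smooth_iota smooth_N_lift_coords)
    show "\<exists>U \<tau>. open U \<and> p \<in> U \<and> smooth_on \<tau> U \<and>
        (\<forall>y\<in>ext_space \<inter> U. (iota \<kappa> \<circ> N_coords \<kappa>) (coset_proj \<kappa> (\<tau> y)) = y)" for p
      using smooth_on_compose[OF smooth smooth_iota_inv[of \<kappa>]]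
      by (intro exI[of _ UNIV] exI[of _ "\<tau> \<circ> iota_inv \<kappa>"]) (simp add: N_coords_coset_proj \<tau>)
    show "ambient_product \<kappa>
        (frechet_derivative (iota \<kappa> \<circ> N_coords \<kappa> \<circ> coset_proj \<kappa>) (at x) X)
        (frechet_derivative (iota \<kappa> \<circ> N_coords \<kappa> \<circ> coset_proj \<kappa>) (at x) Y)
      = N_pullback_metric \<kappa> x X Y" for x X Y
      unfolding comp_assoc comp
      by (simp only: frechet_derivative_smooth_compose[OF smooth_iota smooth_N_lift_coords]
          ambient_product_iota metric)
  qed
qed

section \<open>Point symmetries\<close>

definition N_symmetry :: "real \<Rightarrow> complex \<times> complex \<Rightarrow> complex \<times> complex \<Rightarrow> complex \<times> complex" where
  "N_symmetry \<kappa> p = iota_inv \<kappa> \<circ> ext_reflection \<kappa> (iota \<kappa> p) \<circ> iota \<kappa>"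

lemma iota_N_symmetry: "iota \<kappa> \<circ> N_symmetry \<kappa> p = ext_reflection \<kappa> (iota \<kappa> p) \<circ> iota \<kappa>"
  by (auto simp: N_symmetry_def ext_reflection_in_ext_space)

text \<open>Only sums, pairs and products of projections and constants occur, with negation written
  as a factor -1; this is the shape covered by \<open>Ck_on_intros\<close>.\<close>

lemma ext_reflection_eq_fst_snd:
  "ext_reflection \<kappa> p = (\<lambda>w. (2 *\<^sub>R fst p + (- 1) *\<^sub>R fst w
       + (2 * \<kappa> * (fst (snd w) + (- (1/2)) * (snd (snd p) \<bullet> snd (snd p)) + snd (snd p) \<bullet> snd (snd w))) *\<^sub>R snd (snd p),
     fst (snd w) + 2 * (snd (snd p) \<bullet> snd (snd w)) + (- 2) * (snd (snd p) \<bullet> snd (snd p)),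
     2 *\<^sub>R snd (snd p) + (- 1) *\<^sub>R snd (snd w)))"
  by (cases p) (auto simp: ext_reflection_def)

lemma smooth_ext_reflection: "smooth_on (ext_reflection \<kappa> p) UNIV"
  unfolding ext_reflection_eq_fst_snd smooth_on_def by (intro allI Ck_on_intros Ck_on_projections)

lemma frechet_derivative_ext_reflection:
  "frechet_derivative (ext_reflection \<kappa> p) (at w) = (\<lambda>v.
     (- fst v + (2 * \<kappa> * (fst (snd v) + snd (snd p) \<bullet> snd (snd v))) *\<^sub>R snd (snd p),
      fst (snd v) + 2 * (snd (snd p) \<bullet> snd (snd v)), - snd (snd v)))"
  unfolding ext_reflection_eq_fst_snd
  by (rule frechet_derivative_at[symmetric])
    (auto intro!: derivative_eq_intros simp: fun_eq_iff algebra_simps)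

lemma ambient_product_ext_reflection:
  "ambient_product \<kappa> (frechet_derivative (ext_reflection \<kappa> p) (at w) v)
     (frechet_derivative (ext_reflection \<kappa> p) (at w) v') = ambient_product \<kappa> v v'"
  by (simp add: frechet_derivative_ext_reflection ambient_product_inner inner_commute algebra_simps)

lemma smooth_N_symmetry: "smooth_on (N_symmetry \<kappa> p) UNIV"
  unfolding N_symmetry_def by (intro smooth_on_compose smooth_iota smooth_iota_inv smooth_ext_reflection)

lemma N_symmetry_involution: "N_symmetry \<kappa> p (N_symmetry \<kappa> p \<xi>) = \<xi>"
  by (simp add: N_symmetry_def ext_reflection_in_ext_space ext_reflection_involution)

text \<open>Both sides come from \<open>iota_N_symmetry\<close> by the chain rule. It allows the
  derivative of the symmetry to be studied through the reflection, which is affine.\<close>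

lemma iota_frechet_derivative_N_symmetry:
  "frechet_derivative (iota \<kappa>) (at (N_symmetry \<kappa> p \<xi>)) (frechet_derivative (N_symmetry \<kappa> p) (at \<xi>) v)
    = frechet_derivative (ext_reflection \<kappa> (iota \<kappa> p)) (at (iota \<kappa> \<xi>)) (frechet_derivative (iota \<kappa>) (at \<xi>) v)"
  unfolding frechet_derivative_smooth_compose[OF smooth_iota smooth_N_symmetry, symmetric]
    frechet_derivative_smooth_compose[OF smooth_ext_reflection smooth_iota, symmetric] iota_N_symmetry ..

lemma point_symmetry_N_symmetry: "point_symmetry (N_metric \<kappa>) p (N_symmetry \<kappa> p)"
proof -
  have inv: "inv_into UNIV (N_symmetry \<kappa> p) = N_symmetry \<kappa> p"
    by (rule inv_unique_comp) (auto simp: N_symmetry_involution)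
  have "bij (N_symmetry \<kappa> p)"
    by (rule o_bij[of "N_symmetry \<kappa> p"]) (auto simp: N_symmetry_involution)
  moreover have "N_metric \<kappa> (N_symmetry \<kappa> p \<xi>) (frechet_derivative (N_symmetry \<kappa> p) (at \<xi>) v)
      (frechet_derivative (N_symmetry \<kappa> p) (at \<xi>) w) = N_metric \<kappa> \<xi> v w" for \<xi> v w
    by (simp add: iota_frechet_derivative_N_symmetry ambient_product_ext_reflection flip: ambient_product_iota)
  ultimately have "isometry_onto (N_metric \<kappa>) UNIV (N_metric \<kappa>) (N_symmetry \<kappa> p)"
    by (simp add: isometry_onto_def inv smooth_N_symmetry smooth_on_imp_smooth_map_on)
  moreover have p: "N_symmetry \<kappa> p p = p"
  proof -
    have "ext_reflection \<kappa> (iota \<kappa> p) (iota \<kappa> p) = iota \<kappa> p"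
      by (simp add: ext_reflection_def iota_eq complex_eq_iff)
    then show ?thesis by (simp add: N_symmetry_def)
  qed
  moreover have "(N_symmetry \<kappa> p has_derivative (\<lambda>v. - v)) (at p)"
  proof -
    have "frechet_derivative (N_symmetry \<kappa> p) (at p) v = - v" (is "?D = _") for v
    proof -
      \<comment> \<open>The derivative of \<open>iota\<close> is injective: the last component of
        the equation gives the second component of \<open>?D\<close>, and with it the first
        component gives the other.\<close>
      note eq = iota_frechet_derivative_N_symmetry[of \<kappa> p p v, unfolded p]
      have "snd ?D = - snd v"
        using arg_cong[OF eq, of "\<lambda>w. snd (snd w)"]
        by (simp add: frechet_derivative_iota frechet_derivative_ext_reflection)
      moreover from this have "fst ?D = - fst v"
        using arg_cong[OF eq, of fst]
        by (simp add: frechet_derivative_iota frechet_derivative_ext_reflection algebra_simps)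
          (simp only: eq_neg_iff_add_eq_0 add.commute)
      ultimately show ?thesis by (simp add: prod_eq_iff)
    qed
    then have "frechet_derivative (N_symmetry \<kappa> p) (at p) = (\<lambda>v. - v)" by (rule ext)
    then show ?thesis using smooth_on_frechet_derivative(1)[OF smooth_N_symmetry, of \<kappa> p p] by simp
  qed
  ultimately show ?thesis by (simp add: point_symmetry_def)
qed

lemma point_symmetry_N_metric_iff: "point_symmetry (N_metric \<kappa>) p s \<longleftrightarrow> s = N_symmetry \<kappa> p"
proof
  assume s: "point_symmetry (N_metric \<kappa>) p s"
  have loc: "N.local_isometry \<kappa> s" if "point_symmetry (N_metric \<kappa>) p s" for s
    using that by (simp add: point_symmetry_def isometry_onto_def N.local_isometry_def)
  have der: "frechet_derivative s (at p) = (\<lambda>v. - v)" if "point_symmetry (N_metric \<kappa>) p s" for s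
    using that frechet_derivative_at unfolding point_symmetry_def by metis
  note \<sigma> = point_symmetry_N_symmetry[of \<kappa> p]
  show "s = N_symmetry \<kappa> p"
  proof (rule N_isometry_rigid[OF loc[OF s] loc[OF \<sigma>]])
    show "s p = N_symmetry \<kappa> p p" using s \<sigma> by (simp add: point_symmetry_def)
    show "frechet_derivative s (at p) = frechet_derivative (N_symmetry \<kappa> p) (at p)"
      by (simp only: der[OF s] der[OF \<sigma>])
  qed
qed (simp add: point_symmetry_N_symmetry)

section \<open>The transvection groups\<close>

definition iota_conj :: "real \<Rightarrow> (ambient \<Rightarrow> ambient) \<Rightarrow> complex \<times> complex \<Rightarrow> complex \<times> complex" where
  "iota_conj \<kappa> f = iota_inv \<kappa> \<circ> f \<circ> iota \<kappa>"

text \<open>\<open>iota\<close> undoes \<open>iota_inv\<close> only on M, so the inner factor has to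
  map M into itself.\<close>

lemma iota_conj_comp:
  assumes "g ` ext_space \<subseteq> ext_space"
  shows "iota_conj \<kappa> (f \<circ> g) = iota_conj \<kappa> f \<circ> iota_conj \<kappa> g"
proof
  fix \<xi>
  have "g (iota \<kappa> \<xi>) \<in> ext_space" using assms iota_in_ext_space by blast
  then show "iota_conj \<kappa> (f \<circ> g) \<xi> = (iota_conj \<kappa> f \<circ> iota_conj \<kappa> g) \<xi>"
    by (simp add: iota_conj_def)
qed

lemma iota_conj_id: "iota_conj \<kappa> id = id"
  by (simp add: fun_eq_iff iota_conj_def)

lemma bij_iota_conj:
  assumes "f \<in> Ghat_matrices \<kappa>" shows "bij (iota_conj \<kappa> f)"
proof -
  obtain g where g: "g \<in> Ghat_matrices \<kappa>" "f \<circ> g = id" "g \<circ> f = id"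
  proof -
    obtain X y Z where f: "f = Ghat_map \<kappa> X y Z" using assms by (auto simp: Ghat_matrices_eq)
    show ?thesis
      by (rule that[of "Ghat_map \<kappa> (- X) (- y) (y *\<^sub>R (\<i> * X) - Z)"])
        (simp_all only: f Ghat_map_in Ghat_map_inverse)
  qed
  have "iota_conj \<kappa> g \<circ> iota_conj \<kappa> f = id" "iota_conj \<kappa> f \<circ> iota_conj \<kappa> g = id"
    by (simp_all add: iota_conj_comp[symmetric] Ghat_image_ext_space[OF assms] Ghat_image_ext_space[OF g(1)]
        g iota_conj_id)
  then show ?thesis by (rule o_bij)
qed

lemma iota_conj_hom: "iota_conj \<kappa> \<in> hom (transformation_group (Ghat_matrices \<kappa>)) (BijGroup UNIV)"
proof (rule homI)
  fix f g assume "f \<in> carrier (transformation_group (Ghat_matrices \<kappa>))" "g \<in> carrier (transformation_group (Ghat_matrices \<kappa>))"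
  then have "f \<in> Ghat_matrices \<kappa>" "g \<in> Ghat_matrices \<kappa>" by (simp_all add: transformation_group_simps)
  then show "iota_conj \<kappa> (f \<otimes>\<^bsub>transformation_group (Ghat_matrices \<kappa>)\<^esub> g)
      = iota_conj \<kappa> f \<otimes>\<^bsub>BijGroup UNIV\<^esub> iota_conj \<kappa> g"
    using subgroup_BijGroup_UNIV_bij[OF subgroup_Ghat]
    by (simp add: transformation_group_simps mult_BijGroup_UNIV bij_iota_conj iota_conj_comp Ghat_image_ext_space)
qed (simp add: transformation_group_simps carrier_BijGroup_UNIV bij_iota_conj)

lemma inj_on_iota_conj: "inj_on (iota_conj \<kappa>) (Ghat_matrices \<kappa>)"
proof (rule inj_onI)
  fix f g assume f: "f \<in> Ghat_matrices \<kappa>" and g: "g \<in> Ghat_matrices \<kappa>" and eq: "iota_conj \<kappa> f = iota_conj \<kappa> g"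
  have *: "iota \<kappa> (iota_conj \<kappa> h (iota_inv \<kappa> w)) = h w"
    if "w \<in> ext_space" "h \<in> Ghat_matrices \<kappa>" for w h
  proof -
    have "h w \<in> ext_space" using that Ghat_image_ext_space by blast
    then show ?thesis using that(1) by (simp add: iota_conj_def)
  qed
  obtain X y Z X' y' Z' where fg: "f = Ghat_map \<kappa> X y Z" "g = Ghat_map \<kappa> X' y' Z'"
    using f g by (auto simp: Ghat_matrices_eq)
  show "f = g"
    unfolding fg
  proof (rule Ghat_map_eq_on_ext_space)
    fix w assume w: "w \<in> ext_space"
    show "Ghat_map \<kappa> X y Z w = Ghat_map \<kappa> X' y' Z' w"
      using *[OF w f] *[OF w g] by (simp add: eq flip: fg)
  qed
qed

text \<open>Conjugation by \<open>iota\<close> is a homomorphism on the matrix group and takes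
  products of two reflections to products of two point symmetries; the image of a generated subgroup
  is generated by the images.\<close>

lemma transvections_N_metric:
  assumes "\<kappa> \<noteq> 0"
  shows "transvections (N_metric \<kappa>) = iota_conj \<kappa> ` Ghat_matrices \<kappa>"
proof -
  let ?K = "ext_transvection_generators \<kappa>"
  have K: "?K \<subseteq> Ghat_matrices \<kappa>"
    by (auto simp: ext_transvection_generators_def ext_reflection_comp_in_Ghat)
  have conj: "iota_conj \<kappa> (ext_reflection \<kappa> x \<circ> ext_reflection \<kappa> y)
      = N_symmetry \<kappa> (iota_inv \<kappa> x) \<circ> N_symmetry \<kappa> (iota_inv \<kappa> y)"
    if "x \<in> ext_space" "y \<in> ext_space" for x y
    using that by (simp add: iota_conj_comp ext_reflection_image) (simp add: iota_conj_def N_symmetry_def)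
  have "{s \<circ> t | s t p q. point_symmetry (N_metric \<kappa>) p s \<and> point_symmetry (N_metric \<kappa>) q t}
      = {N_symmetry \<kappa> p \<circ> N_symmetry \<kappa> q | p q. True}"
    by (auto simp: point_symmetry_N_metric_iff)
  also have "\<dots> = iota_conj \<kappa> ` ?K"
  proof (intro equalityI subsetI)
    fix h assume "h \<in> {N_symmetry \<kappa> p \<circ> N_symmetry \<kappa> q | p q. True}"
    then obtain p q where "h = N_symmetry \<kappa> p \<circ> N_symmetry \<kappa> q" by blast
    then have "h = iota_conj \<kappa> (ext_reflection \<kappa> (iota \<kappa> p) \<circ> ext_reflection \<kappa> (iota \<kappa> q))"
      by (simp add: conj)
    then show "h \<in> iota_conj \<kappa> ` ?K"
      unfolding ext_transvection_generators_def using iota_in_ext_space by blast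
  next
    fix h assume "h \<in> iota_conj \<kappa> ` ?K"
    then obtain x y where "x \<in> ext_space" "y \<in> ext_space"
      "h = iota_conj \<kappa> (ext_reflection \<kappa> x \<circ> ext_reflection \<kappa> y)"
      unfolding ext_transvection_generators_def by blast
    then show "h \<in> {N_symmetry \<kappa> p \<circ> N_symmetry \<kappa> q | p q. True}" using conj by blast
  qed
  finally have "transvections (N_metric \<kappa>) = generate (BijGroup UNIV) (iota_conj \<kappa> ` ?K)"
    by (simp add: transvections_def)
  also have "\<dots> = iota_conj \<kappa> ` generate (transformation_group (Ghat_matrices \<kappa>)) ?K"
  proof (rule group_hom.generate_img)
    show "group_hom (transformation_group (Ghat_matrices \<kappa>)) (BijGroup UNIV) (iota_conj \<kappa>)"
      by (intro group_hom.intro group_hom_axioms.intro group_transformation_group[OF subgroup_Ghat]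
          group_BijGroup iota_conj_hom)
    show "?K \<subseteq> carrier (transformation_group (Ghat_matrices \<kappa>))"
      using K by (simp add: transformation_group_simps)
  qed
  \<comment> \<open>The homomorphism lives on the matrix group only, so generation is taken inside
    it and then compared with generation among all bijections.\<close>
  also have "generate (transformation_group (Ghat_matrices \<kappa>)) ?K = Ghat_matrices \<kappa>"
    unfolding transformation_group_def
    by (simp add: group.generate_consistent[OF group_BijGroup K subgroup_Ghat]
        generate_ext_transvection_generators[OF assms])
  finally show ?thesis .
qed

lemma Ghat_iso_transvections:
  assumes "\<kappa> \<noteq> 0"
  shows "transformation_group (Ghat_matrices \<kappa>) \<cong> transformation_group (transvections (N_metric \<kappa>))"
proof (rule is_isoI)
  show "iota_conj \<kappa> \<in> iso (transformation_group (Ghat_matrices \<kappa>)) (transformation_group (transvections (N_metric \<kappa>)))"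
  proof (rule isoI)
    show "iota_conj \<kappa> \<in> hom (transformation_group (Ghat_matrices \<kappa>)) (transformation_group (transvections (N_metric \<kappa>)))"
      using iota_conj_hom[of \<kappa>]
      by (simp add: hom_def transformation_group_simps transvections_N_metric[OF assms])
    show "bij_betw (iota_conj \<kappa>) (carrier (transformation_group (Ghat_matrices \<kappa>)))
        (carrier (transformation_group (transvections (N_metric \<kappa>))))"
      by (simp add: bij_betw_def transformation_group_simps transvections_N_metric[OF assms] inj_on_iota_conj)
  qed
qed

theorem corollary4p18:
  fixes \<kappa> :: real
  assumes "\<kappa> \<in> {1, -1}"
  shows "extrinsic_symmetric (ambient_product \<kappa>) ext_space
    \<and> (\<exists>f. N_isometry_onto \<kappa> ext_space (\<lambda>_. ambient_product \<kappa>) f)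
    \<and> isometry_onto (N_metric \<kappa>) ext_space (\<lambda>_. ambient_product \<kappa>) (iota \<kappa>)
    \<and> extrinsic_transvections (ambient_product \<kappa>) ext_space = Ghat_matrices \<kappa>
    \<and> subgroup (Ghat_matrices \<kappa>) (transformation_group (affine_isometries (ambient_product \<kappa>)))
    \<and> transformation_group (extrinsic_transvections (ambient_product \<kappa>) ext_space)
        \<cong> transformation_group (transvections (N_metric \<kappa>))
    \<and> O2 \<subseteq> special_isometries \<kappa>
    \<and> semidirect_product (transformation_group (extrinsic_isometries (ambient_product \<kappa>) ext_space))
        O2 (extrinsic_transvections (ambient_product \<kappa>) ext_space)"
proof -
  have \<kappa>: "\<kappa> \<noteq> 0" using assms by auto
  have transv: "extrinsic_transvections (ambient_product \<kappa>) ext_space = Ghat_matrices \<kappa>"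
    by (rule extrinsic_transvections_eq[OF \<kappa>])
  have "subgroup (Ghat_matrices \<kappa>) (transformation_group (affine_isometries (ambient_product \<kappa>)))"
    by (rule subgroup_transformation_group[OF subgroup_affine_isometries[OF scalar_product_ambient_product[OF \<kappa>]]
          subgroup_Ghat Ghat_affine_isometries])
  moreover have "\<exists>f. N_isometry_onto \<kappa> ext_space (\<lambda>_. ambient_product \<kappa>) f"
    by (rule exI, rule N_isometry_onto_ext_space)
  ultimately show ?thesis
    unfolding transv
    by (intro conjI extrinsic_symmetric_ext_space[OF \<kappa>] isometry_onto_iota refl Ghat_iso_transvections[OF \<kappa>]
        O2_special_isometries semidirect_product_extrinsic_isometries[OF \<kappa>])
qed

end
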